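(* Let $G$ be a spray on an $n$-dimensional smooth manifold $M$. For any volume form $dV$ on $M$, the spray $\hat G$ associated with $(G,dV)$, i.e. the spray with coefficients $\hat G^i = G^i - \frac{S}{n+1}y^i$ where $S$ is the S-curvature of $(G,dV)$, has vanishing $\chi$-curvature: $\hat\chi = 0$.
   Context: Summation over repeated indices is used. $(x^i,y^i)$ denotes standard local coordinates on $TM$; $TM\setminus 0$ is the set of non-zero tangent vectors. A spray $G$ on $M$ is a vector field on $TM\setminus 0$ locally of the form $G = y^i\frac{\partial}{\partial x^i} - 2G^i\frac{\partial}{\partial y^i}$, where the $G^i=G^i(x,y)$ (the spray coefficients) are local $C^\infty$ functions on non-zero vectors with $G^i(x,\lambda y)=\lambda^2 G^i(x,y)$ for all $\lambda>0$. Put $N^i_j=\frac{\partial G^i}{\partial y^j}$, $\Gamma^i_{jk}=\frac{\partial^2 G^i}{\partial y^j\partial y^k}$, $\frac{\delta}{\delta x^k}=\frac{\partial}{\partial x^k}-N^m_k\frac{\partial}{\partial y^m}$. The Riemann curvature tensor is $R^{\ i}_{j\ kl} = \frac{\delta\Gamma^i_{jl}}{\delta x^k}-\frac{\delta\Gamma^i_{jk}}{\delta x^l}+\Gamma^i_{ks}\Gamma^s_{jl}-\Gamma^s_{jk}\Gamma^i_{ls}$, and $R^i_{\ k}=y^jR^{\ i}_{j\ kl}y^l$. A subscript $\cdot k$ denotes $\frac{\partial}{\partial y^k}$. The $\chi$-curvature of $G$ is $\chi_k = -\frac16\{2R^m_{\ k\cdot m}+R^m_{\ m\cdot k}\}$.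 Hatted quantities are those of $\hat G$. For a volume form $dV=\sigma(x)\,dx^1\cdots dx^n$ ($\sigma>0$), the S-curvature of $(G,dV)$ is $S=\frac{\partial G^m}{\partial y^m}-y^m\frac{\partial}{\partial x^m}(\ln\sigma)$. *)

theory Defs
  imports "HOL-Analysis.Analysis"
begin

section \<open>Smooth maps and smooth manifolds\<close>

text \<open>Only meaningful for open \<open>S\<close>, which is how it is used below.\<close>

primrec times_differentiable_on ::
    "nat \<Rightarrow> 'e::euclidean_space set \<Rightarrow> ('e \<Rightarrow> 'f::real_normed_vector) \<Rightarrow> bool" where
  "times_differentiable_on 0 S f \<longleftrightarrow> continuous_on S f"
| "times_differentiable_on (Suc r) S f \<longleftrightarrow>
     (\<forall>x\<in>S. f differentiable (at x)) \<and>
     (\<forall>v. times_differentiable_on r S (\<lambda>x. frechet_derivative f (at x) v))"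

definition smooth_on :: "'e::euclidean_space set \<Rightarrow> ('e \<Rightarrow> 'f::real_normed_vector) \<Rightarrow> bool" where
  "smooth_on S f \<longleftrightarrow> (\<forall>r. times_differentiable_on r S f)"

type_synonym ('a, 'e) chart = "'a set \<times> ('a \<Rightarrow> 'e)"

abbreviation chart_dom :: "('a, 'e) chart \<Rightarrow> 'a set" where
  "chart_dom \<equiv> fst"

abbreviation chart_map :: "('a, 'e) chart \<Rightarrow> 'a \<Rightarrow> 'e" where
  "chart_map \<equiv> snd"

definition chart_image :: "('a, 'e) chart \<Rightarrow> 'e set" where
  "chart_image c = chart_map c ` chart_dom c"

definition chart_inv :: "('a, 'e) chart \<Rightarrow> 'e \<Rightarrow> 'a" where
  "chart_inv c = inv_into (chart_dom c) (chart_map c)"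

definition overlap :: "('a, 'e) chart \<Rightarrow> ('a, 'e) chart \<Rightarrow> 'e set" where
  "overlap c d = chart_map c ` (chart_dom c \<inter> chart_dom d)"

definition transition :: "('a, 'e) chart \<Rightarrow> ('a, 'e) chart \<Rightarrow> 'e \<Rightarrow> 'e" where
  "transition c d = chart_map d \<circ> chart_inv c"

text \<open>The differential at \<open>p\<close> of the change of coordinates from \<open>c\<close> to \<open>d\<close>.\<close>

definition d_transition ::
    "('a, 'e::euclidean_space) chart \<Rightarrow> ('a, 'e) chart \<Rightarrow> 'a \<Rightarrow> 'e \<Rightarrow> 'e" where
  "d_transition c d p = frechet_derivative (transition c d) (at (chart_map c p))"

text \<open>The atlas is an arbitrary smooth atlas; it may be taken to be the maximal one.\<close>

definition smooth_manifold :: "'a topology \<Rightarrow> ('a, 'e::euclidean_space) chart set \<Rightarrow> bool" where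
  "smooth_manifold M A \<longleftrightarrow>
     Hausdorff_space M \<and> second_countable M \<and>
     topspace M = (\<Union>c\<in>A. chart_dom c) \<and>
     (\<forall>c\<in>A. openin M (chart_dom c) \<and> open (chart_image c) \<and>
        homeomorphic_map (subtopology M (chart_dom c)) (top_of_set (chart_image c)) (chart_map c)) \<and>
     (\<forall>c\<in>A. \<forall>d\<in>A. smooth_on (overlap c d) (transition c d))"

section \<open>Tangent vectors, vector fields and volume forms\<close>

text \<open>
  A tangent vector at \<open>p\<close> is given by its components in all charts of the atlas around \<open>p\<close>, which
  have to be related by the differentials of the coordinate changes. At all other arguments the
  family of components is zero, so that a tangent vector is determined by its components in any one
  chart around \<open>p\<close>.
\<close>

definition tangent_space ::
    "('a, 'e::euclidean_space) chart set \<Rightarrow> 'a \<Rightarrow> (('a, 'e) chart \<Rightarrow> 'e) set" where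
  "tangent_space A p = {w.
     (\<forall>c\<in>A. \<forall>d\<in>A. p \<in> chart_dom c \<longrightarrow> p \<in> chart_dom d \<longrightarrow> w d = d_transition c d p (w c)) \<and>
     (\<forall>c. c \<notin> A \<or> p \<notin> chart_dom c \<longrightarrow> w c = 0)}"

definition component ::
    "('a \<Rightarrow> ('a, 'e) chart \<Rightarrow> 'b) \<Rightarrow> ('a, 'e) chart \<Rightarrow> 'e \<Rightarrow> 'b" where
  "component V c z = V (chart_inv c z) c"

definition vector_field ::
    "('a, 'e::euclidean_space) chart set \<Rightarrow> ('a \<Rightarrow> ('a, 'e) chart \<Rightarrow> 'e) \<Rightarrow> bool" where
  "vector_field A V \<longleftrightarrow>
     (\<forall>p \<in> (\<Union>c\<in>A. chart_dom c). V p \<in> tangent_space A p) \<and>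
     (\<forall>c\<in>A. smooth_on (chart_image c) (component V c))"

text \<open>
  Since \<open>\<sigma> > 0\<close> is required in all charts and no orientation is given, \<open>dV\<close> is a positive smooth
  density, hence the absolute value of the Jacobian. \<^term>\<open>component dV c\<close> is the function \<open>\<sigma>\<close>
  of the chart \<open>c\<close>.
\<close>

definition volume_form ::
    "('a, real^'n) chart set \<Rightarrow> ('a \<Rightarrow> ('a, real^'n) chart \<Rightarrow> real) \<Rightarrow> bool" where
  "volume_form A dV \<longleftrightarrow>
     (\<forall>c\<in>A. smooth_on (chart_image c) (component dV c) \<and> (\<forall>p\<in>chart_dom c. dV p c > 0)) \<and>
     (\<forall>c\<in>A. \<forall>d\<in>A. \<forall>p \<in> chart_dom c \<inter> chart_dom d.
        dV p c = \<bar>det (matrix (d_transition c d p))\<bar> * dV p d)"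

section \<open>Sprays\<close>

type_synonym ('a, 'n) tangent = "'a \<times> (('a, real^'n) chart \<Rightarrow> real^'n)"
type_synonym ('a, 'n) slit_chart = "(('a, 'n) tangent, (real^'n) \<times> (real^'n)) chart"
type_synonym ('a, 'n) slit_field =
  "('a, 'n) tangent \<Rightarrow> ('a, 'n) slit_chart \<Rightarrow> (real^'n) \<times> (real^'n)"

definition slit_tangent_bundle :: "('a, real^'n) chart set \<Rightarrow> ('a, 'n) tangent set" where
  "slit_tangent_bundle A =
     {(p, w). p \<in> (\<Union>c\<in>A. chart_dom c) \<and> w \<in> tangent_space A p \<and> w \<noteq> (\<lambda>_. 0)}"

text \<open>The standard local coordinates \<open>(x, y)\<close> induced by the chart \<open>c\<close>.\<close>

definition slit_chart ::
    "('a, real^'n) chart set \<Rightarrow> ('a, real^'n) chart \<Rightarrow> ('a, 'n) slit_chart" where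
  "slit_chart A c =
     ({(p, w) \<in> slit_tangent_bundle A. p \<in> chart_dom c}, \<lambda>(p, w). (chart_map c p, w c))"

definition spray_coeff ::
    "('a, real^'n) chart set \<Rightarrow> ('a, 'n) slit_field \<Rightarrow> ('a, real^'n) chart
      \<Rightarrow> (real^'n) \<times> (real^'n) \<Rightarrow> real^'n" where
  "spray_coeff A G c z = - (1/2) *\<^sub>R snd (component G (slit_chart A c) z)"

definition spray :: "('a, real^'n) chart set \<Rightarrow> ('a, 'n) slit_field \<Rightarrow> bool" where
  "spray A G \<longleftrightarrow>
     vector_field (slit_chart A ` A) G \<and>
     (\<forall>c\<in>A. \<forall>(x, y) \<in> chart_image (slit_chart A c).
        fst (component G (slit_chart A c) (x, y)) = y \<and>
        (\<forall>l>0. spray_coeff A G c (x, l *\<^sub>R y) = l\<^sup>2 *\<^sub>R spray_coeff A G c (x, y)))"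

section \<open>Curvatures in local coordinates\<close>

definition dx :: "'n \<Rightarrow> ((real^'n) \<times> (real^'n) \<Rightarrow> real) \<Rightarrow> (real^'n) \<times> (real^'n) \<Rightarrow> real" where
  "dx k f z = frechet_derivative f (at z) (axis k 1, 0)"

definition dy :: "'n \<Rightarrow> ((real^'n) \<times> (real^'n) \<Rightarrow> real) \<Rightarrow> (real^'n) \<times> (real^'n) \<Rightarrow> real" where
  "dy k f z = frechet_derivative f (at z) (0, axis k 1)"

context
  fixes G :: "(real^'n) \<times> (real^'n) \<Rightarrow> real^'n"
begin

definition N_coeff :: "'n \<Rightarrow> 'n \<Rightarrow> (real^'n) \<times> (real^'n) \<Rightarrow> real" where
  "N_coeff i j = dy j (\<lambda>z. G z $ i)"

definition Gamma_coeff :: "'n \<Rightarrow> 'n \<Rightarrow> 'n \<Rightarrow> (real^'n) \<times> (real^'n) \<Rightarrow> real" where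
  "Gamma_coeff i j k = dy j (dy k (\<lambda>z. G z $ i))"

definition delta_x ::
    "'n \<Rightarrow> ((real^'n) \<times> (real^'n) \<Rightarrow> real) \<Rightarrow> (real^'n) \<times> (real^'n) \<Rightarrow> real" where
  "delta_x k f z = dx k f z - (\<Sum>m\<in>UNIV. N_coeff m k z * dy m f z)"

text \<open>\<open>Riemann_tensor j i k l\<close> is the component with lower index \<open>j\<close>, upper index \<open>i\<close> and lower
  indices \<open>k\<close>, \<open>l\<close>; \<open>Riemann i k\<close> has upper index \<open>i\<close> and lower index \<open>k\<close>.\<close>

definition Riemann_tensor ::
    "'n \<Rightarrow> 'n \<Rightarrow> 'n \<Rightarrow> 'n \<Rightarrow> (real^'n) \<times> (real^'n) \<Rightarrow> real" where
  "Riemann_tensor j i k l z =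
     delta_x k (Gamma_coeff i j l) z - delta_x l (Gamma_coeff i j k) z
     + (\<Sum>s\<in>UNIV. Gamma_coeff i k s z * Gamma_coeff s j l z)
     - (\<Sum>s\<in>UNIV. Gamma_coeff s j k z * Gamma_coeff i l s z)"

definition Riemann :: "'n \<Rightarrow> 'n \<Rightarrow> (real^'n) \<times> (real^'n) \<Rightarrow> real" where
  "Riemann i k z =
     (\<Sum>j\<in>UNIV. \<Sum>l\<in>UNIV. snd z $ j * Riemann_tensor j i k l z * snd z $ l)"

definition chi_curvature :: "'n \<Rightarrow> (real^'n) \<times> (real^'n) \<Rightarrow> real" where
  "chi_curvature k z =
     - (1/6) * (2 * (\<Sum>m\<in>UNIV. dy m (Riemann m k) z) + (\<Sum>m\<in>UNIV. dy k (Riemann m m) z))"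

definition S_curvature :: "(real^'n \<Rightarrow> real) \<Rightarrow> (real^'n) \<times> (real^'n) \<Rightarrow> real" where
  "S_curvature \<sigma> z =
     (\<Sum>m\<in>UNIV. dy m (\<lambda>z. G z $ m) z)
     - (\<Sum>m\<in>UNIV. snd z $ m * frechet_derivative (\<lambda>x. ln (\<sigma> x)) (at (fst z)) (axis m 1))"

end

definition associated_spray ::
    "('a, real^'n) chart set \<Rightarrow> ('a, 'n) slit_field \<Rightarrow> ('a \<Rightarrow> ('a, real^'n) chart \<Rightarrow> real)
      \<Rightarrow> ('a, 'n) slit_field \<Rightarrow> bool" where
  "associated_spray A G dV Ghat \<longleftrightarrow>
     spray A Ghat \<and>
     (\<forall>c\<in>A. \<forall>z \<in> chart_image (slit_chart A c).
        spray_coeff A Ghat c z =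
          spray_coeff A G c z
          - (S_curvature (spray_coeff A G c) (component dV c) z / (real CARD('n) + 1)) *\<^sub>R snd z)"

end

(*
In a chart, homogeneity and Euler's theorem reduce the chi-curvature to an expression in the trace
N^m_m alone:  chi_k = -1/2 (N_{x^k} - y^l N_{x^l y^k} + 2 G^s N_{y^s y^k})  with  N = N^m_m.
Since S is homogeneous of degree 1 in y, subtracting S y / (n + 1) from the spray coefficients lowers
N by exactly S, so the new trace is y^m d(ln sigma)/dx^m, and the expression above vanishes by
the symmetry of second derivatives.

The associated spray is globally defined because S is a function on the slit tangent bundle. Under a
change of coordinates with Jacobian J, the trace N changes by tr(J^-1 dJ(y)), which by Jacobi's formula
is the change of the derivative of ln sigma in the direction y.
*)

theory Submission
  imports Defs
begin

section \<open>Calculus of smooth functions\<close>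

text \<open>The two halves of the claim are separate. The vanishing of \<open>chi_curvature\<close>
  is a computation inside one chart which starts from the coefficient formula alone, so it covers
  every field that satisfies \<open>associated_spray\<close>. Coordinate changes serve existence: a
  vector field is encoded as a family of components over all charts, so the chartwise correction of
  \<open>G\<close> has to be compatible on overlaps. The local half is shaped by two facts.
  Coefficient functions are known only on the open image of a slit chart, so derivatives are always
  compared through agreement on an open set. And \<open>smooth_on\<close> speaks of iterated
  derivatives in fixed directions, so smoothness of composite expressions is proved by coinduction
  over classes closed under such derivatives.\<close>

definition dir_deriv :: "'e::euclidean_space \<Rightarrow> ('e \<Rightarrow> 'f::real_normed_vector) \<Rightarrow> 'e \<Rightarrow> 'f" where
  "dir_deriv v f z = frechet_derivative f (at z) v"

lemma dir_deriv_eqI: "(f has_derivative f') (at z) \<Longrightarrow> dir_deriv v f z = f' v"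
  unfolding dir_deriv_def by (metis frechet_derivative_at)

lemma has_derivative_dir_deriv:
  "f differentiable (at z) \<Longrightarrow> (f has_derivative (\<lambda>v. dir_deriv v f z)) (at z)"
  unfolding dir_deriv_def frechet_derivative_works[symmetric] by simp

lemma dir_deriv_cong:
  assumes "open S" "z \<in> S" "\<And>x. x \<in> S \<Longrightarrow> f x = g x" "f differentiable (at z)"
  shows "dir_deriv v f z = dir_deriv v g z"
  unfolding dir_deriv_def
  using frechet_derivative_transform_within_open[OF assms(4,1,2)] assms(3) by auto

lemma times_differentiable_on_cong:
  assumes "open S" "\<And>x. x \<in> S \<Longrightarrow> f x = g x" "times_differentiable_on r S f"
  shows "times_differentiable_on r S g"
  using assms(2,3)
proof (induction r arbitrary: f g)
  case 0
  then show ?case by (metis continuous_on_cong times_differentiable_on.simps(1))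
next
  case (Suc r)
  have g: "g differentiable (at x)" if "x \<in> S" for x
  proof -
    have "f differentiable (at x)" using Suc.prems that by simp
    then obtain f' where "(f has_derivative f') (at x)" by (auto simp: differentiable_def)
    from has_derivative_transform_within_open[OF this assms(1) that Suc.prems(1)]
    show ?thesis by (rule differentiableI)
  qed
  have "times_differentiable_on r S (\<lambda>x. frechet_derivative g (at x) v)" for v
  proof (rule Suc.IH)
    show "times_differentiable_on r S (\<lambda>x. frechet_derivative f (at x) v)"
      using Suc.prems by simp
    show "frechet_derivative f (at x) v = frechet_derivative g (at x) v" if "x \<in> S" for x
      using dir_deriv_cong[OF assms(1) that, of f g] Suc.prems that by (simp add: dir_deriv_def)
  qed
  with g show ?case by simp
qed

lemma smooth_on_cong:
  "open S \<Longrightarrow> (\<And>x. x \<in> S \<Longrightarrow> f x = g x) \<Longrightarrow> smooth_on S f \<Longrightarrow> smooth_on S g"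
  unfolding smooth_on_def using times_differentiable_on_cong by blast

lemma smooth_on_differentiable: "smooth_on S f \<Longrightarrow> x \<in> S \<Longrightarrow> f differentiable (at x)"
  unfolding smooth_on_def using times_differentiable_on.simps(2) by blast

lemma smooth_on_dir_deriv: "smooth_on S f \<Longrightarrow> smooth_on S (dir_deriv v f)"
  unfolding smooth_on_def dir_deriv_def[abs_def] using times_differentiable_on.simps(2) by blast

lemma smooth_on_has_derivative:
  "smooth_on S f \<Longrightarrow> x \<in> S \<Longrightarrow> (f has_derivative (\<lambda>v. dir_deriv v f x)) (at x)"
  by (intro has_derivative_dir_deriv smooth_on_differentiable)

text \<open>Induction on the order of differentiability, for all members of \<open>P\<close> at
  once: a class closed under directional derivatives consists of smooth functions, and no formula
  for higher derivatives has to be written down. The family \<open>f'\<close> is tied to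
  \<open>f\<close> only on \<open>S\<close>, hence the passage to \<open>frechet_derivative\<close>
  by congruence on an open set.\<close>

lemma smooth_on_coinduct:
  assumes "open S" "P f"
    and step: "\<And>f. P f \<Longrightarrow> \<exists>f'. (\<forall>x\<in>S. (f has_derivative f' x) (at x)) \<and> (\<forall>v. P (\<lambda>x. f' x v))"
  shows "smooth_on S f"
proof -
  have "times_differentiable_on r S f" for r
    using assms(2)
  proof (induction r arbitrary: f)
    case 0
    then show ?case
      using step[OF 0] by (auto intro!: continuous_at_imp_continuous_on dest: has_derivative_continuous)
  next
    case (Suc r)
    from step[OF Suc.prems] obtain f'
      where f': "\<And>x. x \<in> S \<Longrightarrow> (f has_derivative f' x) (at x)" "\<And>v. P (\<lambda>x. f' x v)" by blast
    have "times_differentiable_on r S (\<lambda>x. frechet_derivative f (at x) v)" for v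
      by (rule times_differentiable_on_cong[OF assms(1) _ Suc.IH[OF f'(2)[of v]]])
        (metis f'(1) frechet_derivative_at)
    then show ?case using f'(1) by (auto simp: differentiable_def)
  qed
  then show ?thesis by (simp add: smooth_on_def)
qed

section \<open>Closure properties of smooth functions\<close>

lemma smooth_on_const: "open S \<Longrightarrow> smooth_on S (\<lambda>x. c)"
  by (rule smooth_on_coinduct[where P = "\<lambda>f. \<exists>c. f = (\<lambda>x. c)"]) (auto intro!: exI[of _ "\<lambda>_ _. 0"])

lemma smooth_on_bounded_linear:
  assumes "open S" "bounded_linear L" shows "smooth_on S L"
proof -
  \<comment> \<open>Constants belong to the class because the derivative of \<open>L\<close> in
    direction \<open>v\<close> is the constant \<open>L v\<close>.\<close>
  have "smooth_on S f" if "f = L \<or> (\<exists>c. f = (\<lambda>x. c))" for f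
  proof (rule smooth_on_coinduct[where P = "\<lambda>f. f = L \<or> (\<exists>c. f = (\<lambda>x. c))", OF assms(1) that], goal_cases deriv)
    case (deriv f)
    then consider "f = L" | c where "f = (\<lambda>x. c)" by blast
    then show ?case
    proof cases
      case 1
      then show ?thesis
        by (auto intro!: exI[of _ "\<lambda>_. L"] bounded_linear_imp_has_derivative assms)
    next
      case 2
      then show ?thesis by (auto intro!: exI[of _ "\<lambda>_ _. 0"])
    qed
  qed
  then show ?thesis by blast
qed

lemma smooth_on_compose_linear:
  assumes "open S" "bounded_linear L" "smooth_on S f"
  shows "smooth_on S (\<lambda>x. L (f x))"
proof -
  have "smooth_on S g" if "\<exists>f. smooth_on S f \<and> g = (\<lambda>x. L (f x))" for g
  proof (rule smooth_on_coinduct[where P = "\<lambda>g. \<exists>f. smooth_on S f \<and> g = (\<lambda>x. L (f x))", OF assms(1) that], goal_cases deriv)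
    case (deriv g)
    then obtain f where f: "smooth_on S f" "g = (\<lambda>x. L (f x))" by blast
    show ?case
      using f by (auto intro!: exI[of _ "\<lambda>x v. L (dir_deriv v f x)"] smooth_on_dir_deriv
          bounded_linear.has_derivative[OF assms(2)] smooth_on_has_derivative
          exI[of _ "\<lambda>x. dir_deriv _ f x"])
  qed
  then show ?thesis using assms(3) by blast
qed

text \<open>As the inner map is linear, differentiating in direction \<open>v\<close> replaces
  \<open>f\<close> by its derivative in the fixed direction \<open>L v\<close>, so the class of
  composites is closed.\<close>

lemma smooth_on_precompose_linear:
  assumes "open S" "bounded_linear L" "smooth_on T f" "\<And>x. x \<in> S \<Longrightarrow> L x \<in> T"
  shows "smooth_on S (\<lambda>x. f (L x))"
proof -
  have "smooth_on S g" if "\<exists>f. smooth_on T f \<and> g = (\<lambda>x. f (L x))" for g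
  proof (rule smooth_on_coinduct[where P = "\<lambda>g. \<exists>f. smooth_on T f \<and> g = (\<lambda>x. f (L x))", OF assms(1) that], goal_cases deriv)
    case (deriv g)
    then obtain f where f: "smooth_on T f" "g = (\<lambda>x. f (L x))" by blast
    have "(g has_derivative (\<lambda>v. dir_deriv (L v) f (L x))) (at x)" if "x \<in> S" for x
      unfolding f(2)
      using has_derivative_compose[OF bounded_linear_imp_has_derivative[OF assms(2)]
          smooth_on_has_derivative[OF f(1) assms(4)[OF that]]] .
    then show ?case
      using f(1) by (auto intro!: exI[of _ "\<lambda>x v. dir_deriv (L v) f (L x)"] smooth_on_dir_deriv
          exI[of _ "dir_deriv (L _) f"])
  qed
  then show ?thesis using assms(3) by blast
qed

lemma smooth_on_add:
  assumes "open S" "smooth_on S f" "smooth_on S g"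
  shows "smooth_on S (\<lambda>x. f x + g x)"
proof -
  have "smooth_on S h" if "\<exists>f g. smooth_on S f \<and> smooth_on S g \<and> h = (\<lambda>x. f x + g x)" for h
  proof (rule smooth_on_coinduct[where P = "\<lambda>h. \<exists>f g. smooth_on S f \<and> smooth_on S g \<and> h = (\<lambda>x. f x + g x)", OF assms(1) that], goal_cases deriv)
    case (deriv h)
    then obtain f g where fg: "smooth_on S f" "smooth_on S g" "h = (\<lambda>x. f x + g x)" by blast
    show ?case
    proof (intro exI[of _ "\<lambda>x v. dir_deriv v f x + dir_deriv v g x"] conjI ballI allI)
      show "(h has_derivative (\<lambda>v. dir_deriv v f x + dir_deriv v g x)) (at x)" if "x \<in> S" for x
        unfolding fg(3) using fg(1,2) that by (intro has_derivative_add smooth_on_has_derivative)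
      show "\<exists>f' g'. smooth_on S f' \<and> smooth_on S g' \<and>
          (\<lambda>x. dir_deriv v f x + dir_deriv v g x) = (\<lambda>x. f' x + g' x)" for v
        using smooth_on_dir_deriv[OF fg(1)] smooth_on_dir_deriv[OF fg(2)] by fast
    qed
  qed
  then show ?thesis using assms(2,3) by blast
qed

lemma smooth_on_sum:
  assumes "open S" "\<And>i. i \<in> I \<Longrightarrow> smooth_on S (f i)"
  shows "smooth_on S (\<lambda>x. \<Sum>i\<in>I. f i x)"
  using assms(2) by (induction I rule: infinite_finite_induct)
    (auto intro: smooth_on_const smooth_on_add assms(1))

text \<open>
  The derivative of a product is not a product, so the coinduction has to run over a class of
  functions that is closed under all these operations at once.
\<close>

inductive smooth_algebra :: "'e::euclidean_space set \<Rightarrow> ('e \<Rightarrow> real) \<Rightarrow> bool" for S where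
  base: "smooth_on S f \<Longrightarrow> smooth_algebra S f"
| add: "smooth_algebra S f \<Longrightarrow> smooth_algebra S g \<Longrightarrow> smooth_algebra S (\<lambda>x. f x + g x)"
| mult: "smooth_algebra S f \<Longrightarrow> smooth_algebra S g \<Longrightarrow> smooth_algebra S (\<lambda>x. f x * g x)"
| inverse: "smooth_algebra S f \<Longrightarrow> (\<And>x. x \<in> S \<Longrightarrow> f x \<noteq> 0) \<Longrightarrow> smooth_algebra S (\<lambda>x. inverse (f x))"
| ln: "smooth_algebra S f \<Longrightarrow> (\<And>x. x \<in> S \<Longrightarrow> f x > 0) \<Longrightarrow> smooth_algebra S (\<lambda>x. ln (f x))"

lemma smooth_algebra_deriv:
  assumes "open S" "smooth_algebra S f"
  shows "\<exists>f'. (\<forall>x\<in>S. (f has_derivative f' x) (at x)) \<and> (\<forall>v. smooth_algebra S (\<lambda>x. f' x v))"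
  using assms(2)
proof induction
  case (base f)
  then show ?case
    using smooth_on_has_derivative smooth_on_dir_deriv smooth_algebra.base
    by (intro exI[of _ "\<lambda>x v. dir_deriv v f x"]) blast
next
  case (add f g)
  then obtain f' g' where
    "\<And>x. x \<in> S \<Longrightarrow> (f has_derivative f' x) (at x)" "\<And>v. smooth_algebra S (\<lambda>x. f' x v)"
    "\<And>x. x \<in> S \<Longrightarrow> (g has_derivative g' x) (at x)" "\<And>v. smooth_algebra S (\<lambda>x. g' x v)"
    by blast
  then show ?case
    by (intro exI[of _ "\<lambda>x v. f' x v + g' x v"] conjI ballI allI
        has_derivative_add smooth_algebra.add) auto
next
  case (mult f g)
  then obtain f' g' where
    "\<And>x. x \<in> S \<Longrightarrow> (f has_derivative f' x) (at x)" "\<And>v. smooth_algebra S (\<lambda>x. f' x v)"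
    "\<And>x. x \<in> S \<Longrightarrow> (g has_derivative g' x) (at x)" "\<And>v. smooth_algebra S (\<lambda>x. g' x v)"
    by blast
  with mult.hyps show ?case
    by (intro exI[of _ "\<lambda>x v. f x * g' x v + f' x v * g x"] conjI ballI allI
        has_derivative_mult smooth_algebra.add smooth_algebra.mult) auto
next
  case (inverse f)
  then obtain f' where
    "\<And>x. x \<in> S \<Longrightarrow> (f has_derivative f' x) (at x)" "\<And>v. smooth_algebra S (\<lambda>x. f' x v)"
    by blast
  \<comment> \<open>The algebra has no constructor for negation, so the sign enters as a product
    with the constant \<open>-1\<close>.\<close>
  moreover from this inverse.hyps
  have "smooth_algebra S (\<lambda>x. (-1) * (inverse (f x) * f' x v * inverse (f x)))" for v
    by (intro smooth_algebra.mult smooth_algebra.inverse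
        smooth_algebra.base[OF smooth_on_const[OF assms(1)]]) auto
  ultimately show ?case using inverse.hyps
    by (intro exI[of _ "\<lambda>x v. (-1) * (inverse (f x) * f' x v * inverse (f x))"])
      (auto intro!: derivative_eq_intros)
next
  case (ln f)
  then obtain f' where
    "\<And>x. x \<in> S \<Longrightarrow> (f has_derivative f' x) (at x)" "\<And>v. smooth_algebra S (\<lambda>x. f' x v)"
    by blast
  moreover have "f x \<noteq> 0" if "x \<in> S" for x using ln.hyps(2)[OF that] by simp
  moreover from calculation ln.hyps have "smooth_algebra S (\<lambda>x. f' x v * inverse (f x))" for v
    by (intro smooth_algebra.mult smooth_algebra.inverse) auto
  ultimately show ?case using ln.hyps
    by (intro exI[of _ "\<lambda>x v. f' x v * inverse (f x)"])
      (auto intro!: derivative_eq_intros simp: divide_inverse)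
qed

lemma smooth_algebra_imp_smooth_on:
  assumes "open S" "smooth_algebra S f" shows "smooth_on S f"
  using assms by (rule smooth_on_coinduct) (rule smooth_algebra_deriv[OF assms(1)])

lemma smooth_on_mult:
  fixes f g :: "'e::euclidean_space \<Rightarrow> real"
  assumes "open S" "smooth_on S f" "smooth_on S g"
  shows "smooth_on S (\<lambda>x. f x * g x)"
  by (rule smooth_algebra_imp_smooth_on[OF assms(1) smooth_algebra.mult[OF assms(2,3)[THEN smooth_algebra.base]]])

lemma smooth_on_ln:
  fixes f :: "'e::euclidean_space \<Rightarrow> real"
  assumes "open S" "smooth_on S f" "\<And>x. x \<in> S \<Longrightarrow> f x > 0"
  shows "smooth_on S (\<lambda>x. ln (f x))"
  by (rule smooth_algebra_imp_smooth_on[OF assms(1) smooth_algebra.ln[OF smooth_algebra.base[OF assms(2)] assms(3)]])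

lemma smooth_on_uminus: "open S \<Longrightarrow> smooth_on S f \<Longrightarrow> smooth_on S (\<lambda>x. - f x)"
  by (rule smooth_on_compose_linear[OF _ bounded_linear_minus[OF bounded_linear_ident]])

lemma smooth_on_diff:
  "open S \<Longrightarrow> smooth_on S f \<Longrightarrow> smooth_on S g \<Longrightarrow> smooth_on S (\<lambda>x. f x - g x)"
  using smooth_on_add[of S f "\<lambda>x. - g x"] smooth_on_uminus[of S g] by simp

text \<open>\<open>smooth_algebra\<close> is real valued; the expansion in a basis carries its
  products over to vector valued functions.\<close>

lemma smooth_on_components:
  fixes f :: "'e::euclidean_space \<Rightarrow> 'f::euclidean_space"
  assumes "open S" "\<And>b. b \<in> Basis \<Longrightarrow> smooth_on S (\<lambda>x. f x \<bullet> b)"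
  shows "smooth_on S f"
proof -
  have "smooth_on S (\<lambda>x. \<Sum>b\<in>Basis. (f x \<bullet> b) *\<^sub>R b)"
    by (rule smooth_on_sum[OF assms(1)
          smooth_on_compose_linear[OF assms(1) bounded_linear_scaleR_left assms(2)]])
  then show ?thesis by (simp add: euclidean_representation)
qed

lemma smooth_on_scaleR:
  fixes f :: "'e::euclidean_space \<Rightarrow> 'f::euclidean_space"
  assumes "open S" "smooth_on S c" "smooth_on S f"
  shows "smooth_on S (\<lambda>x. c x *\<^sub>R f x)"
proof (rule smooth_on_components[OF assms(1)])
  fix b :: 'f
  have "smooth_on S (\<lambda>x. f x \<bullet> b)"
    using smooth_on_compose_linear[OF assms(1) bounded_linear_inner_left assms(3)] .
  from smooth_on_mult[OF assms(1,2) this] show "smooth_on S (\<lambda>x. (c x *\<^sub>R f x) \<bullet> b)"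
    by (simp only: inner_scaleR_left)
qed

subsection \<open>Symmetry of second derivatives\<close>

text \<open>Restriction to a line gives access to one-variable calculus: to the mean value theorem,
  and along rays in a fibre to Euler's theorem.\<close>

lemma smooth_on_line_deriv:
  fixes f :: "'e::euclidean_space \<Rightarrow> real"
  assumes "smooth_on S f" "x + t *\<^sub>R v \<in> S"
  shows "((\<lambda>t. f (x + t *\<^sub>R v)) has_field_derivative dir_deriv v f (x + t *\<^sub>R v)) (at t)"
proof -
  have l: "((\<lambda>t. x + t *\<^sub>R v) has_derivative (\<lambda>s. s *\<^sub>R v)) (at t)"
    by (auto intro!: derivative_eq_intros)
  have "((\<lambda>t. f (x + t *\<^sub>R v)) has_derivative (\<lambda>s. dir_deriv (s *\<^sub>R v) f (x + t *\<^sub>R v))) (at t)"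
    by (rule has_derivative_compose[OF l smooth_on_has_derivative[OF assms]])
  moreover have "dir_deriv (s *\<^sub>R v) f (x + t *\<^sub>R v) = dir_deriv v f (x + t *\<^sub>R v) * s" for s
    using linear_scale[OF has_derivative_linear[OF smooth_on_has_derivative[OF assms]]] by simp
  ultimately show ?thesis by (simp add: has_field_derivative_def)
qed

text \<open>The mean value theorem twice: in direction \<open>u\<close> for the increment of
  \<open>f\<close> by \<open>h v\<close>, then in direction \<open>v\<close> for
  \<open>dir_deriv u f\<close>. The second difference on the left is symmetric in \<open>u\<close>
  and \<open>v\<close>, while the derivative on the right is not visibly so.\<close>

lemma second_difference_mvt:
  fixes f :: "'e::euclidean_space \<Rightarrow> real"
  assumes "smooth_on S f" "h > 0"
    and S: "\<And>s t. 0 \<le> s \<Longrightarrow> s \<le> h \<Longrightarrow> 0 \<le> t \<Longrightarrow> t \<le> h \<Longrightarrow> x + s *\<^sub>R u + t *\<^sub>R v \<in> S"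
  obtains s t where "0 < s" "s < h" "0 < t" "t < h"
    "f (x + h *\<^sub>R u + h *\<^sub>R v) - f (x + h *\<^sub>R u) - f (x + h *\<^sub>R v) + f x
      = h * (h * dir_deriv v (dir_deriv u f) (x + s *\<^sub>R u + t *\<^sub>R v))"
proof -
  let ?p = "\<lambda>s. f ((x + h *\<^sub>R v) + s *\<^sub>R u) - f (x + s *\<^sub>R u)"
  have "\<exists>s>0. s < h \<and> ?p h - ?p 0 = (h - 0) *
      (dir_deriv u f ((x + h *\<^sub>R v) + s *\<^sub>R u) - dir_deriv u f (x + s *\<^sub>R u))"
  proof (intro MVT2 DERIV_diff smooth_on_line_deriv[OF assms(1)] assms(2))
    show "x + h *\<^sub>R v + s *\<^sub>R u \<in> S" if "0 \<le> s" "s \<le> h" for s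
      using S[OF that, of h] assms(2) by (simp add: add_ac)
    show "x + s *\<^sub>R u \<in> S" if "0 \<le> s" "s \<le> h" for s
      using S[OF that, of 0] assms(2) by simp
  qed
  then obtain s where s: "0 < s" "s < h" "?p h - ?p 0 = h *
      (dir_deriv u f ((x + h *\<^sub>R v) + s *\<^sub>R u) - dir_deriv u f (x + s *\<^sub>R u))" by auto
  let ?q = "\<lambda>t. dir_deriv u f ((x + s *\<^sub>R u) + t *\<^sub>R v)"
  have "\<exists>t>0. t < h \<and> ?q h - ?q 0 = (h - 0) * dir_deriv v (dir_deriv u f) ((x + s *\<^sub>R u) + t *\<^sub>R v)"
    using S[of s] s assms(2)
    by (intro MVT2) (auto intro!: smooth_on_line_deriv[OF smooth_on_dir_deriv[OF assms(1)]])
  then obtain t where t: "0 < t" "t < h"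
    "?q h - ?q 0 = h * dir_deriv v (dir_deriv u f) ((x + s *\<^sub>R u) + t *\<^sub>R v)" by auto
  show ?thesis
    using s t by (intro that[of s t]) (simp_all add: add_ac)
qed

text \<open>The symmetric second difference over a small parallelogram makes the two mixed
  derivatives take a common value, each at some point of its own. If they differed at
  \<open>x\<close>, continuity would keep that value within half of the gap from both, which is
  impossible.\<close>

lemma dir_deriv_commute:
  fixes f :: "'e::euclidean_space \<Rightarrow> real"
  assumes "open S" "smooth_on S f" "x \<in> S"
  shows "dir_deriv u (dir_deriv v f) x = dir_deriv v (dir_deriv u f) x"
proof (rule ccontr)
  let ?A = "dir_deriv u (dir_deriv v f)" and ?B = "dir_deriv v (dir_deriv u f)"
  assume "?A x \<noteq> ?B x"
  then have e: "\<bar>?A x - ?B x\<bar> / 2 > 0" by simp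
  have "isCont ?A x" "isCont ?B x"
    by (intro differentiable_imp_continuous_within smooth_on_differentiable[OF _ assms(3)]
        smooth_on_dir_deriv assms)+
  then obtain d1 d2 where d: "d1 > 0" "\<And>y. dist y x < d1 \<Longrightarrow> dist (?A y) (?A x) < \<bar>?A x - ?B x\<bar> / 2"
     "d2 > 0" "\<And>y. dist y x < d2 \<Longrightarrow> dist (?B y) (?B x) < \<bar>?A x - ?B x\<bar> / 2"
    using e unfolding continuous_at_eps_delta by metis
  obtain d3 where d3: "d3 > 0" "\<And>y. dist y x < d3 \<Longrightarrow> y \<in> S"
    using assms(1,3) unfolding open_dist by blast
  define d where "d = min d1 (min d2 d3)"
  \<comment> \<open>The summand 1 keeps the divisor positive when \<open>u\<close> and
    \<open>v\<close> vanish; the factor 2 bounds distances in the parallelogram by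
    \<open>d / 2\<close>, strictly below \<open>d\<close>.\<close>
  define h where "h = d / (2 * (norm u + norm v + 1))"
  have d0: "d > 0" using d(1,3) d3(1) by (simp add: d_def)
  have n: "norm u + norm v + 1 > 0" by (intro add_nonneg_pos add_nonneg_nonneg) auto
  have h0: "h > 0" using d0 n by (simp add: h_def)
  have near: "dist (x + s *\<^sub>R u + t *\<^sub>R v) x < d" if "0 \<le> s" "s \<le> h" "0 \<le> t" "t \<le> h" for s t
  proof -
    have "dist (x + s *\<^sub>R u + t *\<^sub>R v) x = norm (s *\<^sub>R u + t *\<^sub>R v)" by (simp add: dist_norm add.assoc)
    also have "\<dots> \<le> s * norm u + t * norm v" using that by (metis norm_triangle_ineq norm_scaleR abs_of_nonneg)
    also have "\<dots> \<le> h * norm u + h * norm v" using that by (intro add_mono mult_right_mono) auto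
    also have "\<dots> \<le> h * (norm u + norm v + 1)" using h0 by (simp add: algebra_simps)
    also have "\<dots> = d / 2" using n by (simp add: h_def field_simps)
    finally show ?thesis using d0 by simp
  qed
  have inS: "x + s *\<^sub>R u + t *\<^sub>R v \<in> S" "x + t *\<^sub>R v + s *\<^sub>R u \<in> S"
    if "0 \<le> s" "s \<le> h" "0 \<le> t" "t \<le> h" for s t
    using near[OF that] by (auto intro!: d3(2) simp: d_def add_ac)
  obtain s t where st: "0 < s" "s < h" "0 < t" "t < h"
    "f (x + h *\<^sub>R u + h *\<^sub>R v) - f (x + h *\<^sub>R u) - f (x + h *\<^sub>R v) + f x = h * (h * ?B (x + s *\<^sub>R u + t *\<^sub>R v))"
    by (rule second_difference_mvt[OF assms(2) h0, of x u v]) (use inS(1) in auto)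
  obtain s' t' where st': "0 < s'" "s' < h" "0 < t'" "t' < h"
    "f (x + h *\<^sub>R v + h *\<^sub>R u) - f (x + h *\<^sub>R v) - f (x + h *\<^sub>R u) + f x = h * (h * ?A (x + s' *\<^sub>R v + t' *\<^sub>R u))"
    by (rule second_difference_mvt[OF assms(2) h0, of x v u]) (use inS(2) in auto)
  have swap: "x + h *\<^sub>R v + h *\<^sub>R u = x + h *\<^sub>R u + h *\<^sub>R v" by (simp add: add_ac)
  have "h * (h * ?B (x + s *\<^sub>R u + t *\<^sub>R v)) = h * (h * ?A (x + s' *\<^sub>R v + t' *\<^sub>R u))"
    using st(5) st'(5) unfolding swap by linarith
  then have "?B (x + s *\<^sub>R u + t *\<^sub>R v) = ?A (x + s' *\<^sub>R v + t' *\<^sub>R u)" using h0 by simp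
  moreover have "dist (?B (x + s *\<^sub>R u + t *\<^sub>R v)) (?B x) < \<bar>?A x - ?B x\<bar> / 2"
    using near[of s t] st by (intro d(4)) (simp add: d_def)
  moreover have "dist (?A (x + s' *\<^sub>R v + t' *\<^sub>R u)) (?A x) < \<bar>?A x - ?B x\<bar> / 2"
    using near[of t' s'] st' by (intro d(2)) (simp add: d_def add_ac)
  ultimately show False by (simp add: dist_real_def abs_if split: if_splits)
qed

subsection \<open>Rules for directional derivatives\<close>

lemma dir_deriv_const [simp]: "dir_deriv v (\<lambda>x. c) z = 0"
  by (simp add: dir_deriv_def)

lemma dir_deriv_linear: "bounded_linear L \<Longrightarrow> dir_deriv v L z = L v"
  by (intro dir_deriv_eqI bounded_linear_imp_has_derivative)

lemma dir_deriv_add: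
  assumes "smooth_on S f" "smooth_on S g" "z \<in> S"
  shows "dir_deriv v (\<lambda>x. f x + g x) z = dir_deriv v f z + dir_deriv v g z"
  using assms by (intro dir_deriv_eqI has_derivative_add smooth_on_has_derivative)

lemma dir_deriv_diff:
  assumes "smooth_on S f" "smooth_on S g" "z \<in> S"
  shows "dir_deriv v (\<lambda>x. f x - g x) z = dir_deriv v f z - dir_deriv v g z"
  using assms by (intro dir_deriv_eqI has_derivative_diff smooth_on_has_derivative)

lemma dir_deriv_sum:
  assumes "\<And>i. i \<in> I \<Longrightarrow> smooth_on S (f i)" "z \<in> S"
  shows "dir_deriv v (\<lambda>x. \<Sum>i\<in>I. f i x) z = (\<Sum>i\<in>I. dir_deriv v (f i) z)"
  using assms by (intro dir_deriv_eqI has_derivative_sum smooth_on_has_derivative)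

lemma dir_deriv_mult:
  fixes f g :: "'e::euclidean_space \<Rightarrow> real"
  assumes "smooth_on S f" "smooth_on S g" "z \<in> S"
  shows "dir_deriv v (\<lambda>x. f x * g x) z = f z * dir_deriv v g z + dir_deriv v f z * g z"
  using assms by (intro dir_deriv_eqI has_derivative_mult smooth_on_has_derivative)

lemma dir_deriv_cmult:
  fixes f :: "'e::euclidean_space \<Rightarrow> real"
  assumes "smooth_on S f" "z \<in> S"
  shows "dir_deriv v (\<lambda>x. c * f x) z = c * dir_deriv v f z"
  using assms by (intro dir_deriv_eqI has_derivative_mult_right smooth_on_has_derivative)

lemma dir_deriv_expand:
  assumes "smooth_on S f" "z \<in> S" and v: "v = (\<Sum>i\<in>I. c i *\<^sub>R e i)"
  shows "dir_deriv v f z = (\<Sum>i\<in>I. c i *\<^sub>R dir_deriv (e i) f z)"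
proof -
  have "linear (\<lambda>v. dir_deriv v f z)"
    using smooth_on_has_derivative[OF assms(1,2)] has_derivative_linear by blast
  from linear_sum[OF this, of "\<lambda>i. c i *\<^sub>R e i" I] linear_scale[OF this]
  show ?thesis unfolding v by simp
qed

section \<open>Curvature of a spray in a chart\<close>

definition homogeneous ::
    "nat \<Rightarrow> ((real^'n) \<times> (real^'n)) set \<Rightarrow> ((real^'n) \<times> (real^'n) \<Rightarrow> real) \<Rightarrow> bool" where
  "homogeneous r U f \<longleftrightarrow> (\<forall>(x, y) \<in> U. \<forall>l>0. f (x, l *\<^sub>R y) = l ^ r * f (x, y))"

lemma dx_eq_dir_deriv: "dx k = dir_deriv (axis k 1, 0)"
  by (intro ext) (simp add: dx_def dir_deriv_def)

lemma dy_eq_dir_deriv: "dy k = dir_deriv (0, axis k 1)"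
  by (intro ext) (simp add: dy_def dir_deriv_def)

lemma vec_eq_sum_axis: "(y::real^'n) = (\<Sum>j\<in>UNIV. (y $ j) *\<^sub>R axis j 1)"
  using basis_expansion[of y] by (simp add: scalar_mult_eq_scaleR)

lemma vertical_eq_sum: "(0::real^'n, y::real^'n) = (\<Sum>j\<in>UNIV. (y $ j) *\<^sub>R (0, axis j 1))"
  by (subst vec_eq_sum_axis[of y]) (simp add: prod_eq_iff fst_sum snd_sum)

lemma dy_const: "dy k (\<lambda>z. c) z = 0"
  by (simp add: dy_def)

text \<open>Models the coordinate image of the slit tangent bundle over one chart.\<close>

locale cone =
  fixes U :: "((real^'n) \<times> (real^'n)) set"
  assumes open_U: "open U"
    and cone_U: "(x, y) \<in> U \<Longrightarrow> l > 0 \<Longrightarrow> (x, l *\<^sub>R y) \<in> U"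
begin

lemma smooth_dx: "smooth_on U f \<Longrightarrow> smooth_on U (dx k f)"
  unfolding dx_eq_dir_deriv by (rule smooth_on_dir_deriv)

lemma smooth_dy: "smooth_on U f \<Longrightarrow> smooth_on U (dy k f)"
  unfolding dy_eq_dir_deriv by (rule smooth_on_dir_deriv)

lemma smooth_y: "smooth_on U (\<lambda>z. snd z $ m)"
  by (intro smooth_on_bounded_linear open_U bounded_linear_compose[OF bounded_linear_vec_nth]
      bounded_linear_snd)

lemmas smooth = smooth_dx smooth_dy smooth_y smooth_on_const[OF open_U] smooth_on_add[OF open_U]
  smooth_on_diff[OF open_U] smooth_on_mult[OF open_U] smooth_on_sum[OF open_U]

lemma dx_y: "dx k (\<lambda>z. snd z $ m) z = 0" and dy_y: "dy k (\<lambda>z. snd z $ m) z = (if k = m then 1 else 0)"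
  using dir_deriv_linear[OF bounded_linear_compose[OF bounded_linear_vec_nth bounded_linear_snd], of _ m z]
  unfolding dx_eq_dir_deriv dy_eq_dir_deriv by (auto simp: axis_def)

context
  fixes z assumes z: "z \<in> U"
begin

lemmas dy_rules = dir_deriv_add[OF _ _ z, of "f :: _ \<Rightarrow> real" _ "(0, axis k 1)" for f k, folded dy_eq_dir_deriv]
  dir_deriv_diff[OF _ _ z, of "f :: _ \<Rightarrow> real" _ "(0, axis k 1)" for f k, folded dy_eq_dir_deriv]
  dir_deriv_mult[OF _ _ z, of _ _ "(0, axis k 1)" for k, folded dy_eq_dir_deriv]
  dir_deriv_cmult[OF _ z, of _ "(0, axis k 1)" for k, folded dy_eq_dir_deriv]
  dir_deriv_sum[OF _ z, of _ "f :: _ \<Rightarrow> _ \<Rightarrow> real" "(0, axis k 1)" for f k, folded dy_eq_dir_deriv]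

lemmas dx_rules = dir_deriv_add[OF _ _ z, of "f :: _ \<Rightarrow> real" _ "(axis k 1, 0)" for f k, folded dx_eq_dir_deriv]
  dir_deriv_diff[OF _ _ z, of "f :: _ \<Rightarrow> real" _ "(axis k 1, 0)" for f k, folded dx_eq_dir_deriv]
  dir_deriv_mult[OF _ _ z, of _ _ "(axis k 1, 0)" for k, folded dx_eq_dir_deriv]
  dir_deriv_cmult[OF _ z, of _ "(axis k 1, 0)" for k, folded dx_eq_dir_deriv]
  dir_deriv_sum[OF _ z, of _ "f :: _ \<Rightarrow> _ \<Rightarrow> real" "(axis k 1, 0)" for f k, folded dx_eq_dir_deriv]

lemma dy_dy: "smooth_on U f \<Longrightarrow> dy j (dy k f) z = dy k (dy j f) z"
  unfolding dy_eq_dir_deriv by (rule dir_deriv_commute[OF open_U _ z])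

lemma dy_dx: "smooth_on U f \<Longrightarrow> dy j (dx k f) z = dx k (dy j f) z"
  unfolding dy_eq_dir_deriv dx_eq_dir_deriv by (rule dir_deriv_commute[OF open_U _ z])

lemma dx_dx: "smooth_on U f \<Longrightarrow> dx j (dx k f) z = dx k (dx j f) z"
  unfolding dx_eq_dir_deriv by (rule dir_deriv_commute[OF open_U _ z])

lemma dy_cong: "smooth_on U f \<Longrightarrow> (\<And>x. x \<in> U \<Longrightarrow> f x = g x) \<Longrightarrow> dy k f z = dy k g z"
  unfolding dy_eq_dir_deriv by (rule dir_deriv_cong[OF open_U z _ smooth_on_differentiable[OF _ z]])

lemma dx_cong: "smooth_on U f \<Longrightarrow> (\<And>x. x \<in> U \<Longrightarrow> f x = g x) \<Longrightarrow> dx k f z = dx k g z"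
  unfolding dx_eq_dir_deriv by (rule dir_deriv_cong[OF open_U z _ smooth_on_differentiable[OF _ z]])

text \<open>Differentiate \<open>f\<close> along the ray \<open>(x, (1 + t) y)\<close> at
  \<open>t = 0\<close>. The chain rule gives the left side, and homogeneity turns the function into
  \<open>(1 + t) ^ r * f z\<close>, which is legitimate for \<open>t > -1\<close>, where the scale
  is positive.\<close>

lemma euler:
  assumes f: "smooth_on U f" and h: "homogeneous r U f"
  shows "(\<Sum>j\<in>UNIV. snd z $ j * dy j f z) = r * f z"
proof -
  obtain x y where xy: "z = (x, y)" by (cases z)
  have line: "z + t *\<^sub>R (0, y) = (x, (1 + t) *\<^sub>R y)" for t
    by (simp add: xy algebra_simps)
  have "((\<lambda>t. f (z + t *\<^sub>R (0, y))) has_field_derivative dir_deriv (0, y) f z) (at 0)"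
    using smooth_on_line_deriv[OF f, of z 0 "(0, y)"] z by (simp flip: zero_prod_def)
  moreover have "((\<lambda>t. f (z + t *\<^sub>R (0, y))) has_field_derivative r * f z) (at 0)"
  proof (rule has_field_derivative_transform_within_open[of _ _ _ "{-1<..}"])
    show "((\<lambda>t. (1 + t) ^ r * f z) has_field_derivative r * f z) (at 0)"
      by (auto intro!: derivative_eq_intros)
    show "(1 + t) ^ r * f z = f (z + t *\<^sub>R (0, y))" if "t \<in> {-1<..}" for t
    proof -
      have "(1 + t) > 0" using that by simp
      then show ?thesis using h z unfolding line unfolding xy homogeneous_def by auto
    qed
  qed auto
  ultimately have "dir_deriv (0, y) f z = r * f z" by (rule DERIV_unique)
  moreover have "dir_deriv (0, y) f z = (\<Sum>j\<in>UNIV. (y $ j) *\<^sub>R dir_deriv (0, axis j 1) f z)"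
    by (rule dir_deriv_expand[OF f z vertical_eq_sum])
  ultimately show ?thesis by (simp add: xy dy_eq_dir_deriv)
qed

end

text \<open>Obtained by differentiating the identity that expresses homogeneity. Scaling the fibre
  fixes horizontal directions and stretches vertical ones by \<open>l\<close>, so \<open>dx\<close>
  keeps the degree and \<open>dy\<close> lowers it by one.\<close>

lemma dir_deriv_scaled_fibre:
  assumes f: "smooth_on U f" and h: "homogeneous r U f" and z: "(x, y) \<in> U" and l: "l > 0"
  shows "dir_deriv (u, l *\<^sub>R v) f (x, l *\<^sub>R y) = l ^ r * dir_deriv (u, v) f (x, y)"
proof -
  let ?L = "\<lambda>z::(real^'n) \<times> (real^'n). (fst z, l *\<^sub>R snd z)"
  have L: "(?L has_derivative ?L) (at (x, y))"
    by (auto intro!: derivative_eq_intros)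
  have "((\<lambda>z. f (?L z)) has_derivative (\<lambda>w. dir_deriv (?L w) f (x, l *\<^sub>R y))) (at (x, y))"
    using has_derivative_compose[OF L] smooth_on_has_derivative[OF f, of "(x, l *\<^sub>R y)"] cone_U[OF z l]
    by simp
  moreover have "((\<lambda>z. f (?L z)) has_derivative (\<lambda>w. l ^ r * dir_deriv w f (x, y))) (at (x, y))"
    by (rule has_derivative_transform_within_open[OF
          has_derivative_mult_right[OF smooth_on_has_derivative[OF f z]] open_U z])
      (use h l in \<open>auto simp: homogeneous_def\<close>)
  ultimately have "(\<lambda>w. dir_deriv (?L w) f (x, l *\<^sub>R y)) = (\<lambda>w. l ^ r * dir_deriv w f (x, y))"
    by (rule has_derivative_unique)
  from fun_cong[OF this, of "(u, v)"] show ?thesis by simp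
qed

lemma homogeneous_dx:
  "smooth_on U f \<Longrightarrow> homogeneous r U f \<Longrightarrow> homogeneous r U (dx k f)"
  using dir_deriv_scaled_fibre[of f r _ _ _ "axis k 1" 0]
  by (auto simp: homogeneous_def dx_eq_dir_deriv)

lemma homogeneous_dy:
  assumes f: "smooth_on U f" and h: "homogeneous (Suc r) U f"
  shows "homogeneous r U (dy k f)"
  unfolding homogeneous_def
proof (clarify)
  fix x y and l :: real assume z: "(x, y) \<in> U" and l: "l > 0"
  have "l ^ Suc r * dy k f (x, y) = dir_deriv (0, l *\<^sub>R axis k 1) f (x, l *\<^sub>R y)"
    using dir_deriv_scaled_fibre[OF f h z l, of 0 "axis k 1"] by (simp add: dy_eq_dir_deriv)
  also have "\<dots> = l * dy k f (x, l *\<^sub>R y)"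
    using linear_scale[OF has_derivative_linear[OF smooth_on_has_derivative[OF f cone_U[OF z l]]],
        of l "(0, axis k 1)"]
    by (simp add: dy_eq_dir_deriv)
  finally show "dy k f (x, l *\<^sub>R y) = l ^ r * dy k f (x, y)" using l by simp
qed

end

section \<open>Curvatures of a spray in one chart\<close>

locale local_spray = cone U for U :: "((real^'n) \<times> (real^'n)) set" +
  fixes G :: "(real^'n) \<times> (real^'n) \<Rightarrow> real^'n"
  assumes smooth_G: "smooth_on U (\<lambda>z. G z $ i)"
    and homogeneous_G: "homogeneous 2 U (\<lambda>z. G z $ i)"
begin

abbreviation g where "g i \<equiv> (\<lambda>z. G z $ i)"
abbreviation N where "N \<equiv> N_coeff G"
abbreviation \<Gamma> where "\<Gamma> \<equiv> Gamma_coeff G"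

lemma N_eq: "N i j = dy j (g i)" by (simp add: N_coeff_def)

lemma \<Gamma>_eq: "\<Gamma> i j k = dy j (N i k)" by (simp add: Gamma_coeff_def N_coeff_def)

lemma smooth_N: "smooth_on U (N i j)" and smooth_\<Gamma>: "smooth_on U (\<Gamma> i j k)"
  by (auto simp: \<Gamma>_eq N_eq intro!: smooth smooth_G)

lemmas smooth_coeffs = smooth_G smooth_N smooth_\<Gamma>

lemma homogeneous_N: "homogeneous 1 U (N i j)"
  unfolding N_eq by (rule homogeneous_dy[OF smooth_G]) (simp add: homogeneous_G numeral_2_eq_2[symmetric])

lemma homogeneous_\<Gamma>: "homogeneous 0 U (\<Gamma> i j k)"
  unfolding \<Gamma>_eq by (rule homogeneous_dy[OF smooth_N]) (use homogeneous_N in simp)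

context
  fixes z assumes z: "z \<in> U"
begin

abbreviation (input) y where "y j \<equiv> snd z $ j"

lemma \<Gamma>_commute: "\<Gamma> i j k z = \<Gamma> i k j z"
  unfolding \<Gamma>_eq N_eq by (rule dy_dy[OF z smooth_G])

lemma contract_N: "(\<Sum>l\<in>UNIV. y l * N i l z) = 2 * g i z"
  unfolding N_eq using euler[OF z smooth_G homogeneous_G] by simp

lemma contract_\<Gamma>: "(\<Sum>j\<in>UNIV. y j * \<Gamma> i j l z) = N i l z"
  unfolding \<Gamma>_eq using euler[OF z smooth_N homogeneous_N] by simp

text \<open>Third vertical derivatives are symmetric, so \<open>m\<close> and \<open>j\<close> may
  be exchanged; the sum is then Euler's identity in degree 0.\<close>

lemma contract_dy_\<Gamma>: "(\<Sum>j\<in>UNIV. y j * dy m (\<Gamma> i j l) z) = 0"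
proof -
  have "dy m (\<Gamma> i j l) z = dy j (\<Gamma> i m l) z" for j
    unfolding \<Gamma>_eq by (rule dy_dy[OF z smooth_N])
  then show ?thesis using euler[OF z smooth_\<Gamma> homogeneous_\<Gamma>, of i m l] by simp
qed

text \<open>Horizontal derivatives keep the degree, so Euler's identity applies to
  \<open>dx k (g i)\<close> itself; commuting \<open>dx\<close> with \<open>dy\<close> yields the
  contracted sum.\<close>

lemma contract_dx_N: "(\<Sum>l\<in>UNIV. y l * dx k (N i l) z) = 2 * dx k (g i) z"
  using euler[OF z smooth_dx homogeneous_dx, OF smooth_G smooth_G homogeneous_G, of k i]
  unfolding N_eq by (simp add: dy_dx[OF z smooth_G])

lemma contract_dx_\<Gamma>: "(\<Sum>j\<in>UNIV. y j * dx k (\<Gamma> i j l) z) = dx k (N i l) z"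
  using euler[OF z smooth_dx homogeneous_dx, OF smooth_N smooth_N homogeneous_N, of k i l]
  unfolding \<Gamma>_eq by (simp add: dy_dx[OF z smooth_N])

text \<open>The classical expression of the Riemann curvature by spray coefficients. The vertical
  parts of both \<open>delta_x\<close> terms disappear because \<Gamma> is homogeneous of degree 0;
  in the others each contraction with \<open>y\<close> lowers the order of differentiation by
  one.\<close>

lemma Riemann_eq:
  "Riemann G i k z = 2 * dx k (g i) z - (\<Sum>l\<in>UNIV. y l * dx l (N i k) z)
     + 2 * (\<Sum>s\<in>UNIV. g s z * \<Gamma> i k s z) - (\<Sum>s\<in>UNIV. N s k z * N i s z)"
proof -
  \<comment> \<open>Double contraction with \<open>y\<close>. Being linear, it lets the six terms of
    the tensor be evaluated one by one, each in the order of summation that its homogeneity identity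
    needs.\<close>
  define C where "C X = (\<Sum>j\<in>UNIV. \<Sum>l\<in>UNIV. y j * X j l * y l)" for X
  have C1: "C X = (\<Sum>l\<in>UNIV. y l * (\<Sum>j\<in>UNIV. y j * X j l))" for X
    unfolding C_def by (subst sum.swap) (simp add: sum_distrib_left mult_ac)
  have Csum: "C (\<lambda>j l. \<Sum>m\<in>UNIV. X m j l) = (\<Sum>m\<in>UNIV. C (X m))" for X :: "'n \<Rightarrow> 'n \<Rightarrow> 'n \<Rightarrow> real"
  proof -
    have "(\<Sum>m\<in>UNIV. C (X m)) = (\<Sum>j\<in>UNIV. \<Sum>m\<in>UNIV. \<Sum>l\<in>UNIV. y j * X m j l * y l)"
      unfolding C_def by (rule sum.swap)
    also have "\<dots> = (\<Sum>j\<in>UNIV. \<Sum>l\<in>UNIV. \<Sum>m\<in>UNIV. y j * X m j l * y l)"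
      by (rule sum.cong[OF refl], rule sum.swap)
    also have "\<dots> = C (\<lambda>j l. \<Sum>m\<in>UNIV. X m j l)"
      unfolding C_def by (simp add: sum_distrib_left sum_distrib_right)
    finally show ?thesis ..
  qed
  have "Riemann G i k z = C (\<lambda>j l. dx k (\<Gamma> i j l) z) - C (\<lambda>j l. \<Sum>m\<in>UNIV. N m k z * dy m (\<Gamma> i j l) z)
      - C (\<lambda>j l. dx l (\<Gamma> i j k) z) + C (\<lambda>j l. \<Sum>m\<in>UNIV. N m l z * dy m (\<Gamma> i j k) z)
      + C (\<lambda>j l. \<Sum>s\<in>UNIV. \<Gamma> i k s z * \<Gamma> s j l z) - C (\<lambda>j l. \<Sum>s\<in>UNIV. \<Gamma> s j k z * \<Gamma> i l s z)"
    unfolding Riemann_def Riemann_tensor_def delta_x_def C_def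
    by (simp add: ring_distribs sum.distrib sum_subtractf)
  moreover have "C (\<lambda>j l. dx k (\<Gamma> i j l) z) = 2 * dx k (g i) z"
    unfolding C1 contract_dx_\<Gamma> contract_dx_N ..
  moreover have "C (\<lambda>j l. \<Sum>m\<in>UNIV. N m k z * dy m (\<Gamma> i j l) z) = 0"
  proof -
    have "C (\<lambda>j l. N m k z * dy m (\<Gamma> i j l) z)
        = (\<Sum>l\<in>UNIV. y l * (N m k z * (\<Sum>j\<in>UNIV. y j * dy m (\<Gamma> i j l) z)))" for m
      unfolding C1 sum_distrib_left by (simp add: mult_ac)
    then show ?thesis unfolding Csum contract_dy_\<Gamma> by simp
  qed
  moreover have "C (\<lambda>j l. dx l (\<Gamma> i j k) z) = (\<Sum>l\<in>UNIV. y l * dx l (N i k) z)"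
    unfolding C1 contract_dx_\<Gamma> ..
  moreover have "C (\<lambda>j l. \<Sum>m\<in>UNIV. N m l z * dy m (\<Gamma> i j k) z) = 0"
  proof -
    have "C (\<lambda>j l. N m l z * dy m (\<Gamma> i j k) z)
        = (\<Sum>l\<in>UNIV. y l * (N m l z * (\<Sum>j\<in>UNIV. y j * dy m (\<Gamma> i j k) z)))" for m
      unfolding C1 sum_distrib_left by (simp add: mult_ac)
    then show ?thesis unfolding Csum contract_dy_\<Gamma> by simp
  qed
  moreover have "C (\<lambda>j l. \<Sum>s\<in>UNIV. \<Gamma> i k s z * \<Gamma> s j l z) = 2 * (\<Sum>s\<in>UNIV. g s z * \<Gamma> i k s z)"
  proof -
    have "C (\<lambda>j l. \<Gamma> i k s z * \<Gamma> s j l z)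
        = \<Gamma> i k s z * (\<Sum>l\<in>UNIV. y l * (\<Sum>j\<in>UNIV. y j * \<Gamma> s j l z))" for s
      unfolding C1 sum_distrib_left by (simp add: mult_ac)
    then show ?thesis unfolding Csum contract_\<Gamma> contract_N by (simp add: sum_distrib_left mult_ac)
  qed
  moreover have "C (\<lambda>j l. \<Sum>s\<in>UNIV. \<Gamma> s j k z * \<Gamma> i l s z) = (\<Sum>s\<in>UNIV. N s k z * N i s z)"
  proof -
    have "C (\<lambda>j l. \<Gamma> s j k z * \<Gamma> i l s z)
        = (\<Sum>j\<in>UNIV. y j * \<Gamma> s j k z) * (\<Sum>l\<in>UNIV. y l * \<Gamma> i l s z)" for s
      unfolding C_def sum_product by (simp add: mult_ac)
    then show ?thesis unfolding Csum contract_\<Gamma> by simp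
  qed
  ultimately show ?thesis by simp
qed

end

text \<open>The product rule for \<open>Riemann_eq\<close>. The term \<open>dx m (N i k)\<close>
  comes from differentiating the explicit factor \<open>y\<close>, through the Kronecker
  delta.\<close>

lemma dy_Riemann:
  assumes z: "z \<in> U"
  shows "dy m (Riemann G i k) z = 2 * dx k (N i m) z - (\<Sum>l\<in>UNIV. snd z $ l * dx l (\<Gamma> i m k) z)
     - dx m (N i k) z + 2 * (\<Sum>s\<in>UNIV. g s z * dy m (\<Gamma> i k s) z) + 2 * (\<Sum>s\<in>UNIV. N s m z * \<Gamma> i k s z)
     - (\<Sum>s\<in>UNIV. N s k z * \<Gamma> i m s z) - (\<Sum>s\<in>UNIV. \<Gamma> s m k z * N i s z)"
proof -
  have "dy m (Riemann G i k) z = dy m (\<lambda>z. 2 * dx k (g i) z - (\<Sum>l\<in>UNIV. snd z $ l * dx l (N i k) z)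
     + 2 * (\<Sum>s\<in>UNIV. g s z * \<Gamma> i k s z) - (\<Sum>s\<in>UNIV. N s k z * N i s z)) z"
    by (rule dy_cong[OF z, symmetric]) (auto intro!: smooth smooth_coeffs simp: Riemann_eq)
  also have "\<dots> = 2 * dy m (dx k (g i)) z
      - (\<Sum>l\<in>UNIV. snd z $ l * dy m (dx l (N i k)) z + (if m = l then 1 else 0) * dx l (N i k) z)
      + 2 * (\<Sum>s\<in>UNIV. g s z * dy m (\<Gamma> i k s) z + dy m (g s) z * \<Gamma> i k s z)
      - (\<Sum>s\<in>UNIV. N s k z * dy m (N i s) z + dy m (N s k) z * N i s z)"
    by (simp add: dy_rules[OF z] smooth smooth_coeffs dy_y dy_const)
  also have "\<dots> = 2 * dy m (dx k (g i)) z
      - (\<Sum>l\<in>UNIV. snd z $ l * dy m (dx l (N i k)) z) - dx m (N i k) z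
      + 2 * (\<Sum>s\<in>UNIV. g s z * dy m (\<Gamma> i k s) z) + 2 * (\<Sum>s\<in>UNIV. dy m (g s) z * \<Gamma> i k s z)
      - (\<Sum>s\<in>UNIV. N s k z * dy m (N i s) z) - (\<Sum>s\<in>UNIV. dy m (N s k) z * N i s z)"
    by (simp add: sum.distrib if_distrib[of "\<lambda>t. t * _"] sum.delta cong: if_cong)
  finally show ?thesis
    by (simp add: dy_dx[OF z] smooth_coeffs \<Gamma>_eq[symmetric] N_eq[symmetric])
qed

definition N_trace where "N_trace z = (\<Sum>m\<in>UNIV. N m m z)"

lemma smooth_N_trace: "smooth_on U N_trace"
  unfolding N_trace_def[abs_def] by (intro smooth smooth_coeffs)

lemma \<Gamma>_trace:
  assumes z: "z \<in> U" shows "(\<Sum>m\<in>UNIV. \<Gamma> m m k z) = dy k N_trace z"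
proof -
  have "\<Gamma> m m k z = dy k (N m m) z" for m
    using \<Gamma>_commute[OF z, of m m k] by (simp add: \<Gamma>_eq)
  then show ?thesis
    unfolding N_trace_def[abs_def] by (simp add: dy_rules[OF z] smooth_coeffs)
qed

text \<open>The weights 2 and 1 in the chi-curvature are what removes the terms that are not linear
  in the trace: with the abbreviations below, \<open>?B\<close>, \<open>?P\<close> and
  \<open>?Q\<close> contribute -2, -2 and 2 from the doubled divergence and 2, 2 and -2 from the
  gradient. Three copies of the surviving terms remain, hence the factor 1/2.\<close>

lemma chi_curvature_eq:
  assumes z: "z \<in> U"
  shows "chi_curvature G k z = - (1/2) * (dx k N_trace z
     - (\<Sum>l\<in>UNIV. snd z $ l * dx l (dy k N_trace) z) + 2 * (\<Sum>s\<in>UNIV. G z $ s * dy s (dy k N_trace) z))"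
proof -
  have dxN: "(\<Sum>m\<in>UNIV. dx k (N m m) z) = dx k N_trace z"
    unfolding N_trace_def[abs_def] by (simp add: dx_rules[OF z] smooth_coeffs)
  have dx\<Gamma>: "(\<Sum>m\<in>UNIV. dx l (\<Gamma> m m k) z) = dx l (dy k N_trace) z" for l
    using dx_cong[OF z, of "\<lambda>z. \<Sum>m\<in>UNIV. \<Gamma> m m k z" "dy k N_trace" l] \<Gamma>_trace
    by (simp add: dx_rules[OF z] smooth smooth_coeffs)
  have dy\<Gamma>': "(\<Sum>m\<in>UNIV. dy l (\<Gamma> m m s) z) = dy l (dy s N_trace) z" for l s
    using dy_cong[OF z, of "\<lambda>z. \<Sum>m\<in>UNIV. \<Gamma> m m s z" "dy s N_trace" l] \<Gamma>_trace
    by (simp add: dy_rules[OF z] smooth smooth_coeffs)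
  \<comment> \<open>Symmetry of third vertical derivatives moves the divergence index into \<Gamma>,
    which turns a divergence into the derivative of a trace.\<close>
  have dy\<Gamma>: "dy m (\<Gamma> m k s) z = dy s (\<Gamma> m m k) z" for m s
  proof -
    have "dy m (\<Gamma> m k s) z = dy m (\<Gamma> m s k) z"
      by (rule dy_cong[OF z smooth_\<Gamma> \<Gamma>_commute])
    also have "\<dots> = dy s (\<Gamma> m m k) z"
      unfolding \<Gamma>_eq by (rule dy_dy[OF z smooth_N])
    finally show ?thesis .
  qed
  let ?T = "\<Sum>l\<in>UNIV. snd z $ l * dx l (dy k N_trace) z"
  let ?H = "\<Sum>s\<in>UNIV. g s z * dy s (dy k N_trace) z"
  let ?B = "\<Sum>m\<in>UNIV. dx m (N m k) z"
  let ?Q = "\<Sum>m\<in>UNIV. \<Sum>s\<in>UNIV. N s m z * \<Gamma> m k s z"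
  let ?P = "\<Sum>s\<in>UNIV. N s k z * dy s N_trace z"
  have T: "(\<Sum>m\<in>UNIV. \<Sum>l\<in>UNIV. snd z $ l * dx l (\<Gamma> m m k) z) = ?T"
    "(\<Sum>m\<in>UNIV. \<Sum>l\<in>UNIV. snd z $ l * dx l (\<Gamma> m k m) z) = ?T"
  proof -
    show "(\<Sum>m\<in>UNIV. \<Sum>l\<in>UNIV. snd z $ l * dx l (\<Gamma> m m k) z) = ?T"
      by (subst sum.swap) (simp add: sum_distrib_left[symmetric] dx\<Gamma>)
    moreover have "dx l (\<Gamma> m k m) z = dx l (\<Gamma> m m k) z" for m l
      by (rule dx_cong[OF z smooth_\<Gamma> \<Gamma>_commute])
    ultimately show "(\<Sum>m\<in>UNIV. \<Sum>l\<in>UNIV. snd z $ l * dx l (\<Gamma> m k m) z) = ?T" by simp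
  qed
  have H: "(\<Sum>m\<in>UNIV. \<Sum>s\<in>UNIV. g s z * dy m (\<Gamma> m k s) z) = ?H"
    unfolding dy\<Gamma> by (subst sum.swap) (simp add: sum_distrib_left[symmetric] dy\<Gamma>')
  have H': "(\<Sum>m\<in>UNIV. \<Sum>s\<in>UNIV. g s z * dy k (\<Gamma> m m s) z) = ?H"
    by (subst sum.swap) (simp add: sum_distrib_left[symmetric] dy\<Gamma>' dy_dy[OF z smooth_N_trace, of k])
  have P: "(\<Sum>m\<in>UNIV. \<Sum>s\<in>UNIV. N s k z * \<Gamma> m m s z) = ?P"
    by (subst sum.swap) (simp add: sum_distrib_left[symmetric] \<Gamma>_trace[OF z])
  have Q: "(\<Sum>m\<in>UNIV. \<Sum>s\<in>UNIV. \<Gamma> s m k z * N m s z) = ?Q"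
    by (subst sum.swap) (simp add: \<Gamma>_commute[OF z, of _ _ k] mult.commute)
  have Q': "(\<Sum>m\<in>UNIV. \<Sum>s\<in>UNIV. \<Gamma> s k m z * N m s z) = ?Q"
    by (subst sum.swap) (simp add: mult.commute)
  have "(\<Sum>m\<in>UNIV. dy m (Riemann G m k) z) = 2 * dx k N_trace z - ?T - ?B + 2 * ?H + 2 * ?Q - ?P - ?Q"
    unfolding dy_Riemann[OF z]
    by (simp add: sum.distrib sum_subtractf sum_distrib_left[symmetric] dxN T H P Q)
  moreover have "(\<Sum>m\<in>UNIV. dy k (Riemann G m m) z) = 2 * ?B - ?T - dx k N_trace z + 2 * ?H + 2 * ?P - ?Q - ?Q"
    unfolding dy_Riemann[OF z]
    by (simp add: sum.distrib sum_subtractf sum_distrib_left[symmetric] dxN T H' P Q')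
  ultimately show ?thesis unfolding chi_curvature_def by simp
qed

text \<open>The hypothesis on \<open>N_trace\<close> says that the S-curvature with respect to \<open>exp F\<close> vanishes.\<close>

lemma chi_curvature_eq_0:
  assumes F: "smooth_on U F" and F_y: "\<And>m z. z \<in> U \<Longrightarrow> dy m F z = 0"
    and N_F: "\<And>z. z \<in> U \<Longrightarrow> N_trace z = (\<Sum>m\<in>UNIV. snd z $ m * dx m F z)"
    and z: "z \<in> U"
  shows "chi_curvature G k z = 0"
proof -
  have dydx: "dy k (dx m F) z = 0" if "z \<in> U" for k m z
  proof -
    have "dx m (dy k F) z = dx m (\<lambda>z. 0) z"
      by (rule dx_cong[OF that]) (simp_all add: smooth F F_y)
    then show ?thesis using dy_dx[OF that F] by (simp add: dx_eq_dir_deriv)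
  qed
  \<comment> \<open>\<open>F\<close> depends on the base point alone, so only the explicit factor
    \<open>y\<close> is hit by \<open>dy k\<close>.\<close>
  have dyN: "dy k N_trace z = dx k F z" if "z \<in> U" for k z
  proof -
    have "dy k N_trace z = dy k (\<lambda>z. \<Sum>m\<in>UNIV. snd z $ m * dx m F z) z"
      by (rule dy_cong[OF that smooth_N_trace N_F])
    also have "\<dots> = (\<Sum>m\<in>UNIV. (if k = m then 1 else 0) * dx m F z)"
      by (simp add: dy_rules[OF that] smooth F dydx[OF that] dy_y)
    also have "\<dots> = dx k F z"
      by (simp add: if_distrib[of "\<lambda>t. t * _"] sum.delta cong: if_cong)
    finally show ?thesis .
  qed
  have "dx k N_trace z = dx k (\<lambda>z. \<Sum>m\<in>UNIV. snd z $ m * dx m F z) z"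
    by (rule dx_cong[OF z smooth_N_trace N_F])
  also have "\<dots> = (\<Sum>m\<in>UNIV. snd z $ m * dx k (dx m F) z)"
    by (simp add: dx_rules[OF z] smooth F dx_y)
  finally have "dx k N_trace z = (\<Sum>m\<in>UNIV. snd z $ m * dx k (dx m F) z)" .
  moreover have "dx l (dy k N_trace) z = dx k (dx l F) z" for l
    using dx_cong[OF z smooth_dy[OF smooth_N_trace] dyN, of l k] dx_dx[OF z F] by simp
  moreover have "dy s (dy k N_trace) z = 0" for s
    using dy_cong[OF z smooth_dy[OF smooth_N_trace] dyN, of s k] dydx[OF z] by simp
  \<comment> \<open>The first two terms are now the same contraction of the Hessian of
    \<open>F\<close> with \<open>y\<close>, and the third is zero since \<open>dx k F\<close> does
    not depend on the fibre.\<close>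
  ultimately show ?thesis unfolding chi_curvature_eq[OF z] by simp
qed

end

section \<open>The S-curvature and the corrected coefficients in one chart\<close>

locale local_spray_volume = local_spray U G for U :: "((real^'n) \<times> (real^'n)) set" and G +
  fixes X :: "(real^'n) set" and \<sigma> :: "real^'n \<Rightarrow> real"
  assumes open_X: "open X" and U_X: "z \<in> U \<Longrightarrow> fst z \<in> X"
    and smooth_\<sigma>: "smooth_on X \<sigma>" and \<sigma>_pos: "x \<in> X \<Longrightarrow> \<sigma> x > 0"
begin

text \<open>The logarithm of the density pulled back to the bundle, so that it can be differentiated
  by \<open>dx\<close> and \<open>dy\<close> like the spray coefficients.\<close>

definition F where "F z = ln (\<sigma> (fst z))"

abbreviation S where "S \<equiv> S_curvature G \<sigma>"

lemma smooth_ln_\<sigma>: "smooth_on X (\<lambda>x. ln (\<sigma> x))"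
  by (rule smooth_on_ln[OF open_X smooth_\<sigma> \<sigma>_pos])

lemma smooth_F: "smooth_on U F"
  unfolding F_def[abs_def]
  by (rule smooth_on_precompose_linear[OF open_U bounded_linear_fst smooth_ln_\<sigma> U_X])

lemma dir_deriv_F:
  assumes z: "z \<in> U"
  shows "dir_deriv w F z = dir_deriv (fst w) (\<lambda>x. ln (\<sigma> x)) (fst z)"
proof (rule dir_deriv_eqI)
  show "(F has_derivative (\<lambda>w. dir_deriv (fst w) (\<lambda>x. ln (\<sigma> x)) (fst z))) (at z)"
    unfolding F_def[abs_def]
    by (rule has_derivative_compose[OF bounded_linear_imp_has_derivative[OF bounded_linear_fst]
          smooth_on_has_derivative[OF smooth_ln_\<sigma> U_X[OF z]]])
qed

lemma dy_F: "z \<in> U \<Longrightarrow> dy m F z = 0"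
  using linear_0[OF has_derivative_linear[OF smooth_on_has_derivative[OF smooth_ln_\<sigma> U_X]]]
  by (simp add: dy_eq_dir_deriv dir_deriv_F)

lemma S_eq: "z \<in> U \<Longrightarrow> S z = N_trace z - (\<Sum>m\<in>UNIV. snd z $ m * dx m F z)"
  unfolding S_curvature_def N_trace_def N_coeff_def
  by (simp add: dx_eq_dir_deriv dir_deriv_F) (simp add: dir_deriv_def)

lemma smooth_S: "smooth_on U S"
proof (rule smooth_on_cong[OF open_U])
  show "N_trace z - (\<Sum>m\<in>UNIV. snd z $ m * dx m F z) = S z" if "z \<in> U" for z
    by (simp add: S_eq that)
qed (intro smooth smooth_N_trace smooth_F)

text \<open>Both terms have degree 1: the trace of \<open>N\<close> by homogeneity, the density term
  because it is linear in \<open>y\<close> with coefficients depending on the base point.\<close>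

lemma homogeneous_S: "homogeneous 1 U S"
proof -
  have "S (x, l *\<^sub>R y) = l * S (x, y)" if "(x, y) \<in> U" "l > 0" for x y and l :: real
  proof -
    have "N m m (x, l *\<^sub>R y) = l * N m m (x, y)" for m
      using homogeneous_N[of m m] that by (auto simp: homogeneous_def)
    then show ?thesis
      using that cone_U[OF that]
      by (simp add: S_eq N_trace_def dx_eq_dir_deriv dir_deriv_F
          right_diff_distrib sum_distrib_left mult_ac)
  qed
  then show ?thesis by (auto simp: homogeneous_def)
qed

context
  fixes H
  assumes H: "z \<in> U \<Longrightarrow> H z = G z - (S z / (real CARD('n) + 1)) *\<^sub>R snd z"
begin

lemma associated_components:
  "z \<in> U \<Longrightarrow> H z $ i = G z $ i - 1 / (real CARD('n) + 1) * (S z * snd z $ i)"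
  by (simp add: H)

lemma associated_local_spray: "local_spray U H"
proof
  fix i
  show "smooth_on U (\<lambda>z. H z $ i)"
    by (rule smooth_on_cong[OF open_U associated_components[symmetric]])
      (assumption, intro smooth smooth_G smooth_S)
  have "H (x, l *\<^sub>R y) $ i = l\<^sup>2 * H (x, y) $ i" if "(x, y) \<in> U" "l > 0" for x y l
  proof -
    have "G (x, l *\<^sub>R y) $ i = l\<^sup>2 * G (x, y) $ i" "S (x, l *\<^sub>R y) = l * S (x, y)"
      using homogeneous_G[of i] homogeneous_S that by (auto simp: homogeneous_def)
    then show ?thesis
      using that cone_U[OF that]
      by (simp only: associated_components) (simp add: power2_eq_square field_simps)
  qed
  then show "homogeneous 2 U (\<lambda>z. H z $ i)" by (auto simp: homogeneous_def)
qed

lemma associated_chi_curvature_eq_0: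
  assumes "z \<in> U" shows "chi_curvature H k z = 0"
proof -
  interpret H: local_spray U H by (rule associated_local_spray)
  have "H.N_trace z = (\<Sum>m\<in>UNIV. snd z $ m * dx m F z)" if z: "z \<in> U" for z
  proof -
    define c where "c = 1 / (real CARD('n) + 1)"
    have "dy m (\<lambda>z. H z $ m) z = N m m z - c * (S z + snd z $ m * dy m S z)" for m
    proof -
      have "dy m (\<lambda>z. H z $ m) z = dy m (\<lambda>z. G z $ m - c * (S z * snd z $ m)) z"
        unfolding c_def by (rule dy_cong[OF z H.smooth_G associated_components])
      also have "\<dots> = N m m z - c * (S z + snd z $ m * dy m S z)"
        by (simp add: dy_rules[OF z] smooth smooth_G smooth_S dy_y dy_const N_eq algebra_simps)
      finally show ?thesis .
    qed
    then have "H.N_trace z = N_trace z - c * (real CARD('n) * S z + (\<Sum>m\<in>UNIV. snd z $ m * dy m S z))"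
      unfolding H.N_trace_def H.N_eq N_trace_def
      by (simp add: sum_subtractf sum.distrib sum_distrib_left[symmetric])
    \<comment> \<open>The origin of the divisor: differentiating the factor \<open>y\<close> gives
      \<open>CARD('n)\<close> copies of \<open>S\<close>, and Euler's identity in degree 1 gives one
      more.\<close>
    also have "\<dots> = N_trace z - S z"
      using euler[OF z smooth_S homogeneous_S] by (simp add: c_def field_simps)
    also have "\<dots> = (\<Sum>m\<in>UNIV. snd z $ m * dx m F z)"
      by (simp add: S_eq z)
    finally show ?thesis .
  qed
  from H.chi_curvature_eq_0[OF smooth_F dy_F this assms] show ?thesis .
qed

end

end

section \<open>Change of coordinates\<close>

subsection \<open>The logarithmic derivative of a determinant\<close>

text \<open>A permutation other than the identity moves at least two indices. Its product in the
  Leibniz formula with one factor removed therefore still contains an off-diagonal entry of the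
  identity matrix, so only the diagonal term contributes.\<close>

lemma has_derivative_det_at_mat_1:
  fixes f :: "'e::real_normed_vector \<Rightarrow> real^'n^'n"
  assumes f: "\<And>i j. ((\<lambda>x. f x $ i $ j) has_derivative (\<lambda>h. f' h $ i $ j)) (at x)"
    and fx: "f x = mat 1"
  shows "((\<lambda>x. det (f x)) has_derivative (\<lambda>h. trace (f' h))) (at x)"
proof -
  let ?D = "\<lambda>h p. \<Sum>i\<in>UNIV. f' h $ i $ p i * (\<Prod>j\<in>UNIV-{i}. f x $ j $ p j)"
  have D: "of_int (sign p) * ?D h p = (if p = id then trace (f' h) else 0)"
    if p: "p permutes UNIV" for h and p :: "'n \<Rightarrow> 'n"
  proof (cases "p = id")
    case True
    then show ?thesis by (simp add: fx mat_def trace_def)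
  next
    case False
    have "(\<Prod>j\<in>UNIV-{i}. f x $ j $ p j) = 0" for i
    proof -
      have "\<exists>j. j \<noteq> i \<and> p j \<noteq> j"
      proof (rule ccontr)
        assume *: "\<nexists>j. j \<noteq> i \<and> p j \<noteq> j"
        then have "p (p i) = p i \<or> p i = i" by blast
        then have "p i = i" using permutes_inj[OF p] by (auto dest: injD)
        with * have "p = id" by (auto simp: fun_eq_iff)
        with False show False by simp
      qed
      then obtain j where "j \<noteq> i" "p j \<noteq> j" by blast
      then show ?thesis by (intro prod_zero bexI[of _ j]) (auto simp: fx mat_def)
    qed
    with False show ?thesis by (simp del: prod_zero_iff)
  qed
  have "((\<lambda>x. det (f x)) has_derivative
      (\<lambda>h. \<Sum>p | p permutes UNIV. of_int (sign p) * ?D h p)) (at x)"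
    unfolding det_def by (intro has_derivative_sum has_derivative_mult_right has_derivative_prod f)
  moreover have "(\<Sum>p | p permutes UNIV. of_int (sign p) * ?D h p) = trace (f' h)" for h
  proof -
    have "(\<Sum>p | p permutes UNIV. of_int (sign p) * ?D h p)
        = (\<Sum>p | p permutes (UNIV::'n set). if p = id then trace (f' h) else 0)"
      by (intro sum.cong refl D) simp
    also have "\<dots> = trace (f' h)"
      using finite_permutations[of "UNIV :: 'n set"] by (simp add: sum.delta permutes_id)
    finally show ?thesis .
  qed
  ultimately show ?thesis by simp
qed

text \<open>Jacobi's formula. Multiplication by the constant matrix \<open>B\<close> moves the base
  point to the identity, and \<open>det (f x)\<close> undoes the normalisation.\<close>

lemma has_derivative_det:
  fixes f :: "'e::real_normed_vector \<Rightarrow> real^'n^'n"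
  assumes f: "\<And>i j. ((\<lambda>x. f x $ i $ j) has_derivative (\<lambda>h. f' h $ i $ j)) (at x)"
    and B: "B ** f x = mat 1"
  shows "((\<lambda>x. det (f x)) has_derivative (\<lambda>h. det (f x) * trace (B ** f' h))) (at x)"
proof -
  have "((\<lambda>x. (B ** f x) $ i $ j) has_derivative (\<lambda>h. (B ** f' h) $ i $ j)) (at x)" for i j
    unfolding matrix_matrix_mult_def by (auto intro!: has_derivative_sum has_derivative_mult_right f)
  then have "((\<lambda>x. det (B ** f x)) has_derivative (\<lambda>h. trace (B ** f' h))) (at x)"
    by (rule has_derivative_det_at_mat_1) (fact B)
  from has_derivative_mult_right[OF this, of "det (f x)"]
  have "((\<lambda>y. det (f x) * det (B ** f y)) has_derivative (\<lambda>h. det (f x) * trace (B ** f' h))) (at x)" .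
  moreover have "det (f x) * det (B ** f y) = det (f y)" for y
  proof -
    have "det (f x) * det B = 1" using arg_cong[OF B, of det] by (simp add: det_mul mult.commute)
    then show ?thesis by (simp add: det_mul mult.assoc[symmetric])
  qed
  ultimately show ?thesis by simp
qed

lemma matrix_diff_ldistrib:
  fixes A :: "'a::ring_1^'n^'m"
  shows "A ** (B - C) = A ** B - A ** C"
  by (simp add: matrix_matrix_mult_def vec_eq_iff right_diff_distrib sum_subtractf)

subsection \<open>The tangent map and its derivative\<close>

lemma dir_deriv_compose_linear:
  assumes "bounded_linear L" "f differentiable (at x)"
  shows "dir_deriv u (\<lambda>x. L (f x)) x = L (dir_deriv u f x)"
  by (rule dir_deriv_eqI[OF bounded_linear.has_derivative[OF assms(1) has_derivative_dir_deriv[OF assms(2)]]])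

lemma dir_deriv_commute_euclidean:
  fixes f :: "'e::euclidean_space \<Rightarrow> 'f::euclidean_space"
  assumes S: "open S" and f: "smooth_on S f" and x: "x \<in> S"
  shows "dir_deriv u (dir_deriv v f) x = dir_deriv v (dir_deriv u f) x"
proof (rule euclidean_eqI)
  fix b :: 'f
  let ?fb = "\<lambda>x. f x \<bullet> b"
  have fb: "smooth_on S ?fb" by (rule smooth_on_compose_linear[OF S bounded_linear_inner_left f])
  have fst_deriv: "dir_deriv v ?fb y = dir_deriv v f y \<bullet> b" if "y \<in> S" for v y
    by (rule dir_deriv_compose_linear[OF bounded_linear_inner_left smooth_on_differentiable[OF f that]])
  have snd_deriv: "dir_deriv u (dir_deriv v ?fb) x = dir_deriv u (dir_deriv v f) x \<bullet> b" for u v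
  proof -
    have "dir_deriv u (dir_deriv v ?fb) x = dir_deriv u (\<lambda>y. dir_deriv v f y \<bullet> b) x"
      by (rule dir_deriv_cong[OF S x fst_deriv
            smooth_on_differentiable[OF smooth_on_dir_deriv[OF fb] x]])
    also have "\<dots> = dir_deriv u (dir_deriv v f) x \<bullet> b"
      by (rule dir_deriv_compose_linear[OF bounded_linear_inner_left
            smooth_on_differentiable[OF smooth_on_dir_deriv[OF f] x]])
    finally show ?thesis .
  qed
  show "dir_deriv u (dir_deriv v f) x \<bullet> b = dir_deriv v (dir_deriv u f) x \<bullet> b"
    using dir_deriv_commute[OF S fb x, of u v] by (simp only: snd_deriv)
qed

lemma linear_dir_deriv: "smooth_on S f \<Longrightarrow> x \<in> S \<Longrightarrow> linear (\<lambda>v. dir_deriv v f x)"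
  using has_derivative_linear smooth_on_has_derivative by blast

locale coordinate_change =
  fixes W :: "(real^'n) set" and \<phi> :: "real^'n \<Rightarrow> real^'n"
  assumes open_W: "open W" and smooth_\<phi>: "smooth_on W \<phi>"
begin

abbreviation d\<phi> where "d\<phi> x v \<equiv> dir_deriv v \<phi> x"
abbreviation dd\<phi> where "dd\<phi> x u v \<equiv> dir_deriv u (dir_deriv v \<phi>) x"

lemma linear_d\<phi>: "x \<in> W \<Longrightarrow> linear (d\<phi> x)"
  by (rule linear_dir_deriv[OF smooth_\<phi>])

lemma dd\<phi>_commute: "x \<in> W \<Longrightarrow> dd\<phi> x u v = dd\<phi> x v u"
  by (rule dir_deriv_commute_euclidean[OF open_W smooth_\<phi>])

lemma linear_dd\<phi>:
  assumes x: "x \<in> W"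
  shows "linear (\<lambda>u. dd\<phi> x u v)" "linear (\<lambda>v. dd\<phi> x u v)"
proof -
  show *: "linear (\<lambda>u. dd\<phi> x u v)" for v
    by (rule linear_dir_deriv[OF smooth_on_dir_deriv[OF smooth_\<phi>] x])
  show "linear (\<lambda>v. dd\<phi> x u v)"
    using *[of u] by (simp add: dd\<phi>_commute[OF x, of u])
qed

text \<open>Smoothness speaks of derivatives in fixed directions, whereas here the direction
  \<open>snd z\<close> varies with the point. Expanding it in the standard basis leaves a sum of
  products with fixed directions.\<close>

lemma has_derivative_tangent_map:
  assumes x: "x \<in> W"
  shows "((\<lambda>z. (\<phi> (fst z), d\<phi> (fst z) (snd z))) has_derivative
    (\<lambda>w. (d\<phi> x (fst w), d\<phi> x (snd w) + dd\<phi> x (fst w) y))) (at (x, y))"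
proof -
  have fst: "((\<lambda>z. h (fst z)) has_derivative (\<lambda>w. dir_deriv (fst w) h x)) (at (x, y))"
    if "smooth_on W h" for h :: "real^'n \<Rightarrow> real^'n"
    using has_derivative_compose[OF bounded_linear_imp_has_derivative[OF bounded_linear_fst],
        of h "\<lambda>u. dir_deriv u h x" "(x, y)"] smooth_on_has_derivative[OF that x] by simp
  have d: "d\<phi> x v = (\<Sum>j\<in>UNIV. (v $ j) *\<^sub>R d\<phi> x (axis j 1))" if "x \<in> W" for x v
    by (rule dir_deriv_expand[OF smooth_\<phi> that vec_eq_sum_axis])
  have "((\<lambda>z. \<Sum>j\<in>UNIV. (snd z $ j) *\<^sub>R d\<phi> (fst z) (axis j 1)) has_derivative
      (\<lambda>w. \<Sum>j\<in>UNIV. (snd (x, y) $ j) *\<^sub>R dd\<phi> x (fst w) (axis j 1) + (snd w $ j) *\<^sub>R d\<phi> (fst (x, y)) (axis j 1)))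
      (at (x, y))"
    by (intro has_derivative_sum has_derivative_scaleR fst smooth_on_dir_deriv smooth_\<phi>
        bounded_linear_imp_has_derivative bounded_linear_compose[OF bounded_linear_vec_nth bounded_linear_snd])
  moreover have "(\<Sum>j\<in>UNIV. (snd (x, y) $ j) *\<^sub>R dd\<phi> x (fst w) (axis j 1) + (snd w $ j) *\<^sub>R d\<phi> (fst (x, y)) (axis j 1))
      = d\<phi> x (snd w) + dd\<phi> x (fst w) y" for w
  proof -
    have "dd\<phi> x (fst w) y = (\<Sum>j\<in>UNIV. (y $ j) *\<^sub>R dd\<phi> x (fst w) (axis j 1))"
      by (subst vec_eq_sum_axis[of y]) (simp add: linear_sum[OF linear_dd\<phi>(2)[OF x]] linear_scale[OF linear_dd\<phi>(2)[OF x]])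
    then show ?thesis by (simp add: sum.distrib d[OF x, of "snd w"] add.commute)
  qed
  ultimately have "((\<lambda>z. \<Sum>j\<in>UNIV. (snd z $ j) *\<^sub>R d\<phi> (fst z) (axis j 1)) has_derivative
      (\<lambda>w. d\<phi> x (snd w) + dd\<phi> x (fst w) y)) (at (x, y))" by simp
  then have "((\<lambda>z. d\<phi> (fst z) (snd z)) has_derivative (\<lambda>w. d\<phi> x (snd w) + dd\<phi> x (fst w) y)) (at (x, y))"
    by (rule has_derivative_transform_within_open[OF _ open_Times[OF open_W open_UNIV]])
      (use x in \<open>simp_all add: d[symmetric] mem_Times_iff\<close>)
  with fst[OF smooth_\<phi>] show ?thesis by (rule has_derivative_Pair)
qed

text \<open>The factor 2, due to symmetry, is what cancels the 1/2 in the transformation law of the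
  spray coefficients.\<close>

lemma has_derivative_quadratic:
  assumes x: "x \<in> W"
  shows "((\<lambda>y. dd\<phi> x y y) has_derivative (\<lambda>v. 2 *\<^sub>R dd\<phi> x v y)) (at y)"
proof -
  have "bounded_bilinear (dd\<phi> x)"
    unfolding bilinear_conv_bounded_bilinear[symmetric] bilinear_def using linear_dd\<phi>[OF x] by simp
  from bounded_bilinear.FDERIV[OF this has_derivative_ident has_derivative_ident, of y UNIV] show ?thesis
    by (simp add: dd\<phi>_commute[OF x, of y] scaleR_2)
qed

text \<open>Differentiating the law along the fibre gives a matrix identity: the vertical derivative
  of \<open>g\<^sub>d\<close> times the Jacobian equals the Jacobian times that of
  \<open>g\<^sub>c\<close>, minus the matrix of second derivatives. Multiplying by \<open>B\<close>
  and using cyclicity of the trace isolates the defect.\<close>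

lemma trace_spray_coeff_transform:
  assumes x: "x \<in> W" and y: "y \<noteq> 0"
    and c: "g\<^sub>c differentiable (at (x, y))" and d: "g\<^sub>d differentiable (at (\<phi> x, d\<phi> x y))"
    and law: "\<And>y. y \<noteq> 0 \<Longrightarrow> g\<^sub>d (\<phi> x, d\<phi> x y) = d\<phi> x (g\<^sub>c (x, y)) - (1/2) *\<^sub>R dd\<phi> x y y"
    and B: "B ** matrix (d\<phi> x) = mat 1"
  shows "(\<Sum>m\<in>UNIV. dir_deriv (0, axis m 1) g\<^sub>d (\<phi> x, d\<phi> x y) $ m)
    = (\<Sum>m\<in>UNIV. dir_deriv (0, axis m 1) g\<^sub>c (x, y) $ m) - trace (B ** matrix (\<lambda>v. dd\<phi> x v y))"
proof -
  define E\<^sub>c where "E\<^sub>c v = dir_deriv (0, v) g\<^sub>c (x, y)" for v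
  define E\<^sub>d where "E\<^sub>d v = dir_deriv (0, v) g\<^sub>d (\<phi> x, d\<phi> x y)" for v
  let ?H = "\<lambda>v. dd\<phi> x v y"
  have bl: "bounded_linear (d\<phi> x)" using linear_d\<phi>[OF x] by (simp add: linear_conv_bounded_linear)
  have pair: "bounded_linear (\<lambda>v. (0::real^'n, v::real^'n))"
    by (intro bounded_linear_Pair bounded_linear_zero bounded_linear_ident)
  have vert_c: "((\<lambda>y. g\<^sub>c (x, y)) has_derivative E\<^sub>c) (at y)"
    unfolding E\<^sub>c_def[abs_def]
    by (rule has_derivative_compose[where f = "\<lambda>y. (x, y)", OF _ has_derivative_dir_deriv[OF c]])
      (intro has_derivative_Pair has_derivative_const has_derivative_ident)
  have vert_d: "((\<lambda>y. g\<^sub>d (\<phi> x, d\<phi> x y)) has_derivative (\<lambda>v. E\<^sub>d (d\<phi> x v))) (at y)"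
    unfolding E\<^sub>d_def[abs_def]
    by (rule has_derivative_compose[where f = "\<lambda>y. (\<phi> x, d\<phi> x y)", OF _ has_derivative_dir_deriv[OF d]])
      (intro has_derivative_Pair has_derivative_const bounded_linear_imp_has_derivative bl)
  have linE: "linear E\<^sub>c" "linear E\<^sub>d"
  proof -
    show "linear E\<^sub>c" using vert_c by (rule has_derivative_linear)
    have "linear (\<lambda>v. dir_deriv v g\<^sub>d (\<phi> x, d\<phi> x y))"
      using has_derivative_linear[OF has_derivative_dir_deriv[OF d]] .
    from linear_compose[OF bounded_linear.linear[OF pair] this] show "linear E\<^sub>d"
      by (simp add: E\<^sub>d_def[abs_def] o_def)
  qed
  have "((\<lambda>y. d\<phi> x (g\<^sub>c (x, y)) - (1/2) *\<^sub>R dd\<phi> x y y) has_derivative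
      (\<lambda>v. d\<phi> x (E\<^sub>c v) - (1/2) *\<^sub>R (2 *\<^sub>R ?H v))) (at y)"
    by (intro has_derivative_diff has_derivative_scaleR_right bounded_linear.has_derivative[OF bl]
        vert_c has_derivative_quadratic x)
  from has_derivative_transform_within_open[OF this open_delete[OF open_UNIV, of 0], of "\<lambda>y. g\<^sub>d (\<phi> x, d\<phi> x y)"]
  have "((\<lambda>y. g\<^sub>d (\<phi> x, d\<phi> x y)) has_derivative (\<lambda>v. d\<phi> x (E\<^sub>c v) - (1/2) *\<^sub>R (2 *\<^sub>R ?H v))) (at y)"
    using y law by simp
  from has_derivative_unique[OF vert_d this]
  have "(\<lambda>v. E\<^sub>d (d\<phi> x v)) = (\<lambda>v. d\<phi> x (E\<^sub>c v) - ?H v)" by simp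
  then have "matrix (E\<^sub>d \<circ> d\<phi> x) = matrix (d\<phi> x \<circ> E\<^sub>c) - matrix ?H"
    by (simp add: fun_eq_iff matrix_def vec_eq_iff)
  then have EJ: "matrix E\<^sub>d ** matrix (d\<phi> x) = matrix (d\<phi> x) ** matrix E\<^sub>c - matrix ?H"
    using linE linear_d\<phi>[OF x] by (simp add: matrix_compose)
  have B': "matrix (d\<phi> x) ** B = mat 1" using B by (simp add: matrix_left_right_inverse)
  have "trace (matrix E\<^sub>d) = trace (matrix E\<^sub>d ** (matrix (d\<phi> x) ** B))"
    by (simp add: B')
  also have "\<dots> = trace (B ** (matrix E\<^sub>d ** matrix (d\<phi> x)))"
    by (subst trace_mul_sym) (simp add: matrix_mul_assoc)
  also have "\<dots> = trace (B ** matrix (d\<phi> x) ** matrix E\<^sub>c) - trace (B ** matrix ?H)"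
    by (simp add: EJ matrix_diff_ldistrib trace_sub matrix_mul_assoc)
  finally have "trace (matrix E\<^sub>d) = trace (matrix E\<^sub>c) - trace (B ** matrix ?H)"
    by (simp add: B)
  then show ?thesis by (simp add: trace_def matrix_def E\<^sub>c_def E\<^sub>d_def)
qed

text \<open>The logarithm of the density law, differentiated by Jacobi's formula. The trace that
  arises is the defect in \<open>trace_spray_coeff_transform\<close>, so the two cancel in the
  S-curvature.\<close>

lemma ln_volume_transform:
  assumes x: "x \<in> W"
    and c: "open X\<^sub>c" "smooth_on X\<^sub>c \<sigma>\<^sub>c" "\<And>x. x \<in> X\<^sub>c \<Longrightarrow> \<sigma>\<^sub>c x > 0" "x \<in> X\<^sub>c"
    and d: "open X\<^sub>d" "smooth_on X\<^sub>d \<sigma>\<^sub>d" "\<And>x. x \<in> X\<^sub>d \<Longrightarrow> \<sigma>\<^sub>d x > 0" "\<And>x. x \<in> W \<Longrightarrow> \<phi> x \<in> X\<^sub>d"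
    and law: "\<And>x. x \<in> W \<Longrightarrow> \<sigma>\<^sub>c x = \<bar>det (matrix (d\<phi> x))\<bar> * \<sigma>\<^sub>d (\<phi> x)"
    and B: "B ** matrix (d\<phi> x) = mat 1"
  shows "dir_deriv y (\<lambda>x. ln (\<sigma>\<^sub>c x)) x
    = trace (B ** matrix (\<lambda>v. dd\<phi> x v y)) + dir_deriv (d\<phi> x y) (\<lambda>x. ln (\<sigma>\<^sub>d x)) (\<phi> x)"
proof -
  let ?J = "\<lambda>x. matrix (d\<phi> x)" and ?J' = "\<lambda>h. matrix (\<lambda>v. dd\<phi> x h v)"
  have "((\<lambda>x. ?J x $ i $ j) has_derivative (\<lambda>h. ?J' h $ i $ j)) (at x)" for i j
    unfolding matrix_def
    using bounded_linear.has_derivative[OF bounded_linear_vec_nth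
        smooth_on_has_derivative[OF smooth_on_dir_deriv[OF smooth_\<phi>] x]] by simp
  note det' = has_derivative_det[OF this B]
  have det: "det (?J x) \<noteq> 0" using arg_cong[OF B, of det] by (auto simp: det_mul)
  have ln_d: "((\<lambda>x. ln (\<sigma>\<^sub>d (\<phi> x))) has_derivative
      (\<lambda>v. dir_deriv (d\<phi> x v) (\<lambda>x. ln (\<sigma>\<^sub>d x)) (\<phi> x))) (at x)"
    by (rule has_derivative_compose[OF smooth_on_has_derivative[OF smooth_\<phi> x]
          smooth_on_has_derivative[OF smooth_on_ln[OF d(1-3)] d(4)[OF x]]])
  \<comment> \<open>The square takes the place of the absolute value, which is awkward to differentiate.\<close>
  have deriv: "((\<lambda>x. ln ((det (?J x))\<^sup>2) / 2 + ln (\<sigma>\<^sub>d (\<phi> x))) has_derivative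
      (\<lambda>v. trace (B ** ?J' v) + dir_deriv (d\<phi> x v) (\<lambda>x. ln (\<sigma>\<^sub>d x)) (\<phi> x))) (at x)"
  proof (rule has_derivative_add[OF _ ln_d])
    show "((\<lambda>x. ln ((det (?J x))\<^sup>2) / 2) has_derivative (\<lambda>v. trace (B ** ?J' v))) (at x)"
    proof -
      have "((\<lambda>t. ln (t\<^sup>2) / 2) has_field_derivative 1 / det (?J x)) (at (det (?J x)))"
        using det by (auto intro!: derivative_eq_intros
            simp: power2_eq_square field_simps zero_less_mult_iff linorder_neq_iff)
      from DERIV_compose_FDERIV[OF this det'] show ?thesis using det by simp
    qed
  qed
  have eq: "ln ((det (?J x))\<^sup>2) / 2 + ln (\<sigma>\<^sub>d (\<phi> x)) = ln (\<sigma>\<^sub>c x)" if "x \<in> W \<inter> X\<^sub>c" for x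
  proof -
    have pos: "\<sigma>\<^sub>d (\<phi> x) > 0" "\<bar>det (?J x)\<bar> * \<sigma>\<^sub>d (\<phi> x) > 0"
      using that c(3)[of x] d(3)[OF d(4), of x] by (auto simp: law)
    then have "det (?J x) \<noteq> 0" by auto
    moreover have "ln ((det (?J x))\<^sup>2) = 2 * ln \<bar>det (?J x)\<bar>"
      using \<open>det (?J x) \<noteq> 0\<close> ln_realpow[of "\<bar>det (?J x)\<bar>" 2] by simp
    ultimately show ?thesis using that pos by (simp add: law ln_mult)
  qed
  have "((\<lambda>x. ln (\<sigma>\<^sub>c x)) has_derivative
      (\<lambda>v. trace (B ** ?J' v) + dir_deriv (d\<phi> x v) (\<lambda>x. ln (\<sigma>\<^sub>d x)) (\<phi> x))) (at x)"
    by (rule has_derivative_transform_within_open[OF deriv open_Int[OF open_W c(1)] _ eq])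
      (use x c(4) in auto)
  \<comment> \<open>The Jacobian differentiated in direction \<open>y\<close> has \<open>y\<close>
    in the outer slot of the second derivative; symmetry moves it to the inner one.\<close>
  from dir_deriv_eqI[OF this, of y] show ?thesis
    using dd\<phi>_commute[OF x, of y] by simp
qed

end

section \<open>The tangent bundle of a manifold\<close>

lemma S_curvature_eq:
  assumes g: "smooth_on U g" "z \<in> U" and \<sigma>: "smooth_on X (\<lambda>x. ln (\<sigma> x))" "fst z \<in> X"
  shows "S_curvature g \<sigma> z
    = (\<Sum>m\<in>UNIV. dir_deriv (0, axis m 1) g z $ m) - dir_deriv (snd z) (\<lambda>x. ln (\<sigma> x)) (fst z)"
proof -
  have "dy m (\<lambda>z. g z $ m) z = dir_deriv (0, axis m 1) g z $ m" for m
    unfolding dy_eq_dir_deriv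
    by (rule dir_deriv_compose_linear[OF bounded_linear_vec_nth smooth_on_differentiable[OF g]])
  moreover have "dir_deriv (snd z) (\<lambda>x. ln (\<sigma> x)) (fst z)
      = (\<Sum>m\<in>UNIV. snd z $ m * dir_deriv (axis m 1) (\<lambda>x. ln (\<sigma> x)) (fst z))"
    using dir_deriv_expand[OF \<sigma> vec_eq_sum_axis[of "snd z"]] by simp
  ultimately show ?thesis by (simp add: S_curvature_def dir_deriv_def)
qed

lemma tangent_space_transition:
  "w \<in> tangent_space A p \<Longrightarrow> c \<in> A \<Longrightarrow> d \<in> A \<Longrightarrow> p \<in> chart_dom c \<Longrightarrow> p \<in> chart_dom d \<Longrightarrow>
    w d = d_transition c d p (w c)"
  unfolding tangent_space_def by blast

locale atlas =
  fixes M :: "'a topology" and A :: "('a, real^'n) chart set"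
  assumes manifold: "smooth_manifold M A"
begin

lemma openin_chart_dom: "c \<in> A \<Longrightarrow> openin M (chart_dom c)"
  and open_chart_image: "c \<in> A \<Longrightarrow> open (chart_image c)"
  and homeomorphic_chart: "c \<in> A \<Longrightarrow>
    homeomorphic_map (subtopology M (chart_dom c)) (top_of_set (chart_image c)) (chart_map c)"
  and smooth_transition: "c \<in> A \<Longrightarrow> d \<in> A \<Longrightarrow> smooth_on (overlap c d) (transition c d)"
  using manifold unfolding smooth_manifold_def by auto

lemma inj_on_chart: "c \<in> A \<Longrightarrow> inj_on (chart_map c) (chart_dom c)"
  using homeomorphic_imp_injective_map[OF homeomorphic_chart] openin_subset[OF openin_chart_dom]
  by (simp add: topspace_subtopology Int_absorb1)

lemma chart_inv_map: "c \<in> A \<Longrightarrow> p \<in> chart_dom c \<Longrightarrow> chart_inv c (chart_map c p) = p"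
  unfolding chart_inv_def by (rule inv_into_f_f[OF inj_on_chart])

lemma open_chart_map_image:
  assumes "c \<in> A" "openin M V" shows "open (chart_map c ` (chart_dom c \<inter> V))"
proof -
  have "openin (subtopology M (chart_dom c)) (chart_dom c \<inter> V)"
    using assms(2) by (auto simp: openin_subtopology)
  then have "openin (top_of_set (chart_image c)) (chart_map c ` (chart_dom c \<inter> V))"
    using homeomorphic_imp_open_map[OF homeomorphic_chart[OF assms(1)]] by (auto simp: open_map_def)
  then show ?thesis using open_chart_image[OF assms(1)] openin_open_trans by blast
qed

lemma open_overlap: "c \<in> A \<Longrightarrow> d \<in> A \<Longrightarrow> open (overlap c d)"
  unfolding overlap_def by (rule open_chart_map_image[OF _ openin_chart_dom])

lemma transition_apply:
  "c \<in> A \<Longrightarrow> p \<in> chart_dom c \<Longrightarrow> transition c d (chart_map c p) = chart_map d p"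
  by (simp add: transition_def chart_inv_map)

lemma coordinate_change: "c \<in> A \<Longrightarrow> d \<in> A \<Longrightarrow> coordinate_change (overlap c d) (transition c d)"
  by (simp add: coordinate_change_def open_overlap smooth_transition)

lemma d_transition_eq: "d_transition c d p v = dir_deriv v (transition c d) (chart_map c p)"
  by (simp add: d_transition_def dir_deriv_def)

lemma in_overlap: "p \<in> chart_dom c \<Longrightarrow> p \<in> chart_dom d \<Longrightarrow> chart_map c p \<in> overlap c d"
  by (auto simp: overlap_def)

lemma has_derivative_transition:
  assumes "c \<in> A" "d \<in> A" "p \<in> chart_dom c" "p \<in> chart_dom d"
  shows "(transition c d has_derivative d_transition c d p) (at (chart_map c p))"
  unfolding d_transition_eq[abs_def]
  using smooth_on_has_derivative[OF smooth_transition in_overlap] assms by blast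

lemma linear_d_transition:
  "c \<in> A \<Longrightarrow> d \<in> A \<Longrightarrow> p \<in> chart_dom c \<Longrightarrow> p \<in> chart_dom d \<Longrightarrow> linear (d_transition c d p)"
  using has_derivative_linear has_derivative_transition by blast

text \<open>The chain rule. The transitions compose as required on the image of the triple overlap,
  which is open and hence enough for the derivative at \<open>p\<close>.\<close>

lemma d_transition_compose:
  assumes "c \<in> A" "d \<in> A" "e \<in> A" "p \<in> chart_dom c" "p \<in> chart_dom d" "p \<in> chart_dom e"
  shows "d_transition d e p (d_transition c d p v) = d_transition c e p v"
proof -
  let ?W = "chart_map c ` (chart_dom c \<inter> (chart_dom d \<inter> chart_dom e))"
  have W: "open ?W"
    using assms by (intro open_chart_map_image openin_Int openin_chart_dom)
  have "(transition d e has_derivative d_transition d e p) (at (transition c d (chart_map c p)))"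
    using has_derivative_transition[of d e p] assms by (simp add: transition_apply)
  with has_derivative_transition[of c d p] assms
  have "((\<lambda>x. transition d e (transition c d x)) has_derivative (\<lambda>v. d_transition d e p (d_transition c d p v)))
      (at (chart_map c p))"
    using has_derivative_compose by blast
  then have "(transition c e has_derivative (\<lambda>v. d_transition d e p (d_transition c d p v))) (at (chart_map c p))"
    by (rule has_derivative_transform_within_open[OF _ W]) (use assms in \<open>auto simp: transition_apply\<close>)
  from has_derivative_unique[OF this has_derivative_transition] assms
  have "(\<lambda>v. d_transition d e p (d_transition c d p v)) = d_transition c e p" by blast
  then show ?thesis by metis
qed

lemma d_transition_self:
  assumes "c \<in> A" "p \<in> chart_dom c" shows "d_transition c c p v = v"
proof -
  have "((\<lambda>x. x) has_derivative (\<lambda>v. v)) (at (chart_map c p))" by (rule has_derivative_ident)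
  then have "(transition c c has_derivative (\<lambda>v. v)) (at (chart_map c p))"
    by (rule has_derivative_transform_within_open[OF _ open_overlap[OF assms(1,1)]])
      (use assms in \<open>auto simp: overlap_def transition_apply\<close>)
  from has_derivative_unique[OF this has_derivative_transition] assms
  have "(\<lambda>v. v) = d_transition c c p" by blast
  then show ?thesis by metis
qed

text \<open>Inverse to taking the component in chart \<open>c\<close>; the value 0 elsewhere is the
  default that \<open>tangent_space\<close> prescribes.\<close>

definition tangent_of :: "('a, real^'n) chart \<Rightarrow> 'a \<Rightarrow> real^'n \<Rightarrow> ('a, real^'n) chart \<Rightarrow> real^'n" where
  "tangent_of c p v e = (if e \<in> A \<and> p \<in> chart_dom e then d_transition c e p v else 0)"

lemma tangent_of_in:
  "c \<in> A \<Longrightarrow> p \<in> chart_dom c \<Longrightarrow> tangent_of c p v \<in> tangent_space A p"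
  by (auto simp: tangent_space_def tangent_of_def d_transition_compose)

lemma tangent_of_self: "c \<in> A \<Longrightarrow> p \<in> chart_dom c \<Longrightarrow> tangent_of c p v c = v"
  by (simp add: tangent_of_def d_transition_self)

lemma tangent_of_component:
  assumes "c \<in> A" "p \<in> chart_dom c" "w \<in> tangent_space A p"
  shows "tangent_of c p (w c) = w"
proof
  fix e
  show "tangent_of c p (w c) e = w e"
  proof (cases "e \<in> A \<and> p \<in> chart_dom e")
    case True
    then show ?thesis using tangent_space_transition[OF assms(3,1)] assms(2) by (simp add: tangent_of_def)
  next
    case False
    then have "w e = 0" using assms(3) unfolding tangent_space_def by blast
    with False show ?thesis by (auto simp: tangent_of_def)
  qed
qed

text \<open>By linearity of the transition differentials, a vector that vanishes in one chart
  vanishes in all of them, so being nonzero can be tested in a single chart.\<close>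

lemma tangent_component_eq_0_iff:
  assumes "c \<in> A" "p \<in> chart_dom c" "w \<in> tangent_space A p"
  shows "w c = 0 \<longleftrightarrow> w = (\<lambda>_. 0)"
proof
  assume "w c = 0"
  then have "w = tangent_of c p 0" using tangent_of_component[OF assms] by simp
  also have "\<dots> = (\<lambda>_. 0)"
    using assms(1,2) by (auto simp: fun_eq_iff tangent_of_def linear_0[OF linear_d_transition])
  finally show "w = (\<lambda>_. 0)" .
qed simp

section \<open>Induced charts on the slit tangent bundle\<close>

abbreviation sc where "sc c \<equiv> slit_chart A c"

lemma slit_chart_dom:
  "(p, w) \<in> chart_dom (sc c) \<longleftrightarrow> (p, w) \<in> slit_tangent_bundle A \<and> p \<in> chart_dom c"
  by (auto simp: slit_chart_def)

lemma slit_chart_map: "chart_map (sc c) (p, w) = (chart_map c p, w c)"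
  by (simp add: slit_chart_def)

lemma slit_tangent_bundle_iff:
  assumes "c \<in> A" "p \<in> chart_dom c"
  shows "(p, w) \<in> slit_tangent_bundle A \<longleftrightarrow> w \<in> tangent_space A p \<and> w c \<noteq> 0"
proof -
  have "(p, w) \<in> slit_tangent_bundle A \<longleftrightarrow> w \<in> tangent_space A p \<and> w \<noteq> (\<lambda>_. 0)"
    using assms unfolding slit_tangent_bundle_def by blast
  then show ?thesis using tangent_component_eq_0_iff[OF assms] by blast
qed

lemma tangent_of_in_slit_dom:
  "c \<in> A \<Longrightarrow> p \<in> chart_dom c \<Longrightarrow> y \<noteq> 0 \<Longrightarrow> (p, tangent_of c p y) \<in> chart_dom (sc c)"
  by (simp add: slit_chart_dom slit_tangent_bundle_iff tangent_of_in tangent_of_self)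

lemma slit_chart_image: "c \<in> A \<Longrightarrow> chart_image (sc c) = chart_image c \<times> (- {0})"
proof (intro equalityI subsetI)
  assume c: "c \<in> A"
  fix z :: "(real^'n) \<times> (real^'n)" assume z: "z \<in> chart_image c \<times> (- {0})"
  then obtain p y where p: "p \<in> chart_dom c" "z = (chart_map c p, y)" "y \<noteq> 0"
    by (auto simp: chart_image_def)
  then have "z = chart_map (sc c) (p, tangent_of c p y)"
    using c by (simp add: slit_chart_map tangent_of_self)
  then show "z \<in> chart_image (sc c)"
    using tangent_of_in_slit_dom[OF c p(1,3)] by (auto simp: chart_image_def)
qed (auto simp: chart_image_def slit_chart_dom slit_chart_map slit_tangent_bundle_iff)

lemma open_slit_chart_image: "c \<in> A \<Longrightarrow> open (chart_image (sc c))"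
  unfolding slit_chart_image by (intro open_Times open_chart_image open_Compl closed_singleton)

lemma inj_on_slit_chart:
  assumes c: "c \<in> A" shows "inj_on (chart_map (sc c)) (chart_dom (sc c))"
proof (rule inj_onI, clarify)
  fix p w q u
  assume *: "(p, w) \<in> chart_dom (sc c)" "(q, u) \<in> chart_dom (sc c)"
    "chart_map (sc c) (p, w) = chart_map (sc c) (q, u)"
  then have p: "p \<in> chart_dom c" "q = p"
    using inj_on_chart[OF c] by (auto simp: slit_chart_dom slit_chart_map dest: inj_onD)
  then have "w c = u c" "w \<in> tangent_space A p" "u \<in> tangent_space A p"
    using * c by (auto simp: slit_chart_dom slit_chart_map slit_tangent_bundle_iff)
  then show "p = q \<and> w = u"
    using p tangent_of_component[OF c p(1)] by metis
qed

lemma slit_chart_inv_map: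
  "c \<in> A \<Longrightarrow> v \<in> chart_dom (sc c) \<Longrightarrow> chart_inv (sc c) (chart_map (sc c) v) = v"
  unfolding chart_inv_def by (rule inv_into_f_f[OF inj_on_slit_chart])

lemma component_slit_chart:
  "c \<in> A \<Longrightarrow> v \<in> chart_dom (sc c) \<Longrightarrow> component V (sc c) (chart_map (sc c) v) = V v (sc c)"
  by (simp add: component_def slit_chart_inv_map)

lemma slit_chart_map_change:
  assumes "c \<in> A" "d \<in> A" "v \<in> chart_dom (sc c)" "v \<in> chart_dom (sc d)"
    and "chart_map (sc c) v = (x, y)"
  shows "x \<in> overlap c d" "y \<noteq> 0"
    "chart_map (sc d) v = (transition c d x, dir_deriv y (transition c d) x)"
proof -
  obtain p w where v: "v = (p, w)" by (cases v)
  have p: "p \<in> chart_dom c" "p \<in> chart_dom d" "w \<in> tangent_space A p" "w c \<noteq> 0"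
    using assms(3,4) slit_tangent_bundle_iff[OF assms(1)] by (auto simp: v slit_chart_dom)
  have xy: "x = chart_map c p" "y = w c" using assms(5) by (simp_all add: v slit_chart_map)
  have "w d = d_transition c d p (w c)"
    by (rule tangent_space_transition[OF p(3) assms(1,2) p(1,2)])
  then show "x \<in> overlap c d" "y \<noteq> 0"
    "chart_map (sc d) v = (transition c d x, dir_deriv y (transition c d) x)"
    using p assms(1) by (auto simp: v slit_chart_map xy in_overlap transition_apply d_transition_eq)
qed

lemma overlap_slit_point:
  assumes "c \<in> A" "d \<in> A" "x \<in> overlap c d" "y \<noteq> 0"
  obtains v where "v \<in> chart_dom (sc c)" "v \<in> chart_dom (sc d)" "chart_map (sc c) v = (x, y)"
proof -
  obtain p where p: "p \<in> chart_dom c" "p \<in> chart_dom d" "x = chart_map c p"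
    using assms(3) by (auto simp: overlap_def)
  from tangent_of_in_slit_dom[OF assms(1) p(1) assms(4)] p assms(1)
  show ?thesis
    by (intro that[of "(p, tangent_of c p y)"]) (auto simp: slit_chart_dom slit_chart_map tangent_of_self)
qed

lemma transition_slit_chart:
  assumes "c \<in> A" "d \<in> A" "x \<in> overlap c d" "y \<noteq> 0"
  shows "transition (sc c) (sc d) (x, y) = (transition c d x, dir_deriv y (transition c d) x)"
proof -
  obtain v where v: "v \<in> chart_dom (sc c)" "v \<in> chart_dom (sc d)" "chart_map (sc c) v = (x, y)"
    using overlap_slit_point[OF assms] .
  have "chart_inv (sc c) (x, y) = v" using slit_chart_inv_map[OF assms(1) v(1)] v(3) by simp
  then show ?thesis
    using slit_chart_map_change(3)[OF assms(1,2) v] by (simp add: transition_def)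
qed

text \<open>Between slit charts the change of coordinates is the tangent map of the base transition.
  Its differential feeds horizontal components into vertical ones through second derivatives, the
  source of the inhomogeneous term for spray coefficients.\<close>

lemma d_transition_slit_chart:
  assumes "c \<in> A" "d \<in> A" "v \<in> chart_dom (sc c)" "v \<in> chart_dom (sc d)"
    and xy: "chart_map (sc c) v = (x, y)"
  shows "d_transition (sc c) (sc d) v w = (dir_deriv (fst w) (transition c d) x,
    dir_deriv (snd w) (transition c d) x + dir_deriv (fst w) (dir_deriv y (transition c d)) x)"
proof -
  interpret coordinate_change "overlap c d" "transition c d"
    by (rule coordinate_change[OF assms(1,2)])
  note x = slit_chart_map_change[OF assms]
  have "open (overlap c d \<times> - {0 :: real^'n})"
    by (intro open_Times open_W open_Compl closed_singleton)
  from has_derivative_transform_within_open[OF has_derivative_tangent_map[OF x(1)] this]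
  have "(transition (sc c) (sc d) has_derivative
      (\<lambda>w. (d\<phi> x (fst w), d\<phi> x (snd w) + dd\<phi> x (fst w) y))) (at (x, y))"
    using x transition_slit_chart[OF assms(1,2)] by auto
  from dir_deriv_eqI[OF this, of w] show ?thesis
    unfolding d_transition_def xy dir_deriv_def[symmetric] .
qed

end

section \<open>The spray associated with a volume form\<close>

locale spray_volume = atlas M A for M :: "'a topology" and A :: "('a, real^'n) chart set" +
  fixes G :: "('a, 'n) slit_field" and dV :: "'a \<Rightarrow> ('a, real^'n) chart \<Rightarrow> real"
  assumes spray: "spray A G" and volume_form: "volume_form A dV"
begin

abbreviation U where "U c \<equiv> chart_image (sc c)"
abbreviation coeff where "coeff c \<equiv> spray_coeff A G c"
abbreviation \<sigma> where "\<sigma> c \<equiv> component dV c"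
abbreviation Scurv where "Scurv c \<equiv> S_curvature (coeff c) (\<sigma> c)"

lemma smooth_component: "c \<in> A \<Longrightarrow> smooth_on (U c) (component G (sc c))"
  using spray unfolding spray_def vector_field_def by blast

lemma component_G: "c \<in> A \<Longrightarrow> z \<in> U c \<Longrightarrow> component G (sc c) z = (snd z, (-2) *\<^sub>R coeff c z)"
  using spray unfolding spray_def by (fastforce simp: spray_coeff_def prod_eq_iff)

lemma smooth_spray_coeff: "c \<in> A \<Longrightarrow> smooth_on (U c) (coeff c)"
  unfolding spray_coeff_def[abs_def]
  by (rule smooth_on_compose_linear[OF open_slit_chart_image
        bounded_linear_compose[OF bounded_linear_scaleR_right bounded_linear_snd] smooth_component])

lemma local_spray_volume:
  assumes c: "c \<in> A"
  shows "local_spray_volume (U c) (coeff c) (chart_image c) (\<sigma> c)"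
proof
  show "open (U c)" "open (chart_image c)"
    by (simp_all add: c open_slit_chart_image open_chart_image)
  show "(x, l *\<^sub>R y) \<in> U c" if "(x, y) \<in> U c" "l > 0" for x y and l :: real
    using that by (simp add: slit_chart_image c)
  show "smooth_on (U c) (\<lambda>z. coeff c z $ i)" for i
    by (rule smooth_on_compose_linear[OF open_slit_chart_image[OF c] bounded_linear_vec_nth
          smooth_spray_coeff[OF c]])
  show "homogeneous 2 (U c) (\<lambda>z. coeff c z $ i)" for i
    using spray c unfolding spray_def homogeneous_def by fastforce
  show "fst z \<in> chart_image c" if "z \<in> U c" for z
    using that by (auto simp: slit_chart_image c)
  show "smooth_on (chart_image c) (\<sigma> c)"
    using volume_form c by (simp add: volume_form_def)
  show "\<sigma> c x > 0" if x: "x \<in> chart_image c" for x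
  proof -
    obtain p where p: "p \<in> chart_dom c" "x = chart_map c p"
      using x by (auto simp: chart_image_def)
    have "dV p c > 0" using volume_form c p(1) unfolding volume_form_def by blast
    then show ?thesis using p c by (simp add: component_def chart_inv_map)
  qed
qed

text \<open>Compare the vertical parts of the components \<open>(y, -2 G)\<close> of the field in
  both charts, and divide by -2.\<close>

lemma spray_coeff_transform:
  assumes "c \<in> A" "d \<in> A" and x: "x \<in> overlap c d" and y: "y \<noteq> 0"
  shows "coeff d (transition c d x, dir_deriv y (transition c d) x)
    = dir_deriv (coeff c (x, y)) (transition c d) x - (1/2) *\<^sub>R dir_deriv y (dir_deriv y (transition c d)) x"
proof -
  interpret coordinate_change "overlap c d" "transition c d"
    by (rule coordinate_change[OF assms(1,2)])
  obtain v where v: "v \<in> chart_dom (sc c)" "v \<in> chart_dom (sc d)" "chart_map (sc c) v = (x, y)"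
    using overlap_slit_point[OF assms] .
  note vd = slit_chart_map_change(3)[OF assms(1,2) v]
  have U: "(x, y) \<in> U c" "(transition c d x, d\<phi> x y) \<in> U d"
    using v(1,2) unfolding v(3)[symmetric] vd[symmetric] chart_image_def by blast+
  have Gc: "G v (sc c) = (y, (-2) *\<^sub>R coeff c (x, y))"
    using component_slit_chart[OF assms(1) v(1), of G] component_G[OF assms(1) U(1)] v(3) by simp
  have Gd: "G v (sc d) = (d\<phi> x y, (-2) *\<^sub>R coeff d (transition c d x, d\<phi> x y))"
    using component_slit_chart[OF assms(2) v(2), of G] component_G[OF assms(2) U(2)] vd by simp
  have "G v \<in> tangent_space (sc ` A) v"
    using spray v(1) assms(1) unfolding spray_def vector_field_def by blast
  from tangent_space_transition[OF this imageI[OF assms(1)] imageI[OF assms(2)] v(1,2)]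
  have "G v (sc d) = d_transition (sc c) (sc d) v (G v (sc c))" .
  then have "(-2) *\<^sub>R coeff d (transition c d x, d\<phi> x y) = d\<phi> x ((-2) *\<^sub>R coeff c (x, y)) + dd\<phi> x y y"
    unfolding Gc Gd d_transition_slit_chart[OF assms(1,2) v] by simp
  also have "d\<phi> x ((-2) *\<^sub>R coeff c (x, y)) = (-2) *\<^sub>R d\<phi> x (coeff c (x, y))"
    by (rule linear_scale[OF linear_d\<phi>[OF x]])
  finally have "(-1/2) *\<^sub>R (-2) *\<^sub>R coeff d (transition c d x, d\<phi> x y)
      = (-1/2) *\<^sub>R ((-2) *\<^sub>R d\<phi> x (coeff c (x, y)) + dd\<phi> x y y)" by (rule arg_cong)
  then show ?thesis by (simp add: algebra_simps)
qed

lemma volume_transform: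
  assumes "c \<in> A" "d \<in> A" "x \<in> overlap c d"
  shows "\<sigma> c x = \<bar>det (matrix (\<lambda>v. dir_deriv v (transition c d) x))\<bar> * \<sigma> d (transition c d x)"
proof -
  obtain p where p: "p \<in> chart_dom c" "p \<in> chart_dom d" "x = chart_map c p"
    using assms(3) by (auto simp: overlap_def)
  then have "dV p c = \<bar>det (matrix (d_transition c d p))\<bar> * dV p d"
    using volume_form assms(1,2) unfolding volume_form_def by blast
  then show ?thesis
    using p assms(1,2)
    by (simp add: component_def chart_inv_map transition_apply d_transition_eq[abs_def])
qed

text \<open>The trace of the vertical derivative and the logarithmic derivative of the density
  change by the same trace, which drops out of their difference.\<close>

lemma S_curvature_invariant:
  assumes "c \<in> A" "d \<in> A" and x: "x \<in> overlap c d" and y: "y \<noteq> 0"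
  shows "Scurv d (transition c d x, dir_deriv y (transition c d) x) = Scurv c (x, y)"
proof -
  interpret coordinate_change "overlap c d" "transition c d"
    by (rule coordinate_change[OF assms(1,2)])
  interpret c: local_spray_volume "U c" "coeff c" "chart_image c" "\<sigma> c"
    by (rule local_spray_volume[OF assms(1)])
  interpret d: local_spray_volume "U d" "coeff d" "chart_image d" "\<sigma> d"
    by (rule local_spray_volume[OF assms(2)])
  obtain v where v: "v \<in> chart_dom (sc c)" "v \<in> chart_dom (sc d)" "chart_map (sc c) v = (x, y)"
    using overlap_slit_point[OF assms] .
  have U: "(x, y) \<in> U c" "(transition c d x, d\<phi> x y) \<in> U d"
    using v(1,2) unfolding v(3)[symmetric] slit_chart_map_change(3)[OF assms(1,2) v, symmetric]
      chart_image_def by blast+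
  have "\<sigma> c x > 0" using c.\<sigma>_pos c.U_X[OF U(1)] by simp
  \<comment> \<open>Since both densities are positive, their transformation law excludes a vanishing
    Jacobian.\<close>
  then have "det (matrix (d\<phi> x)) \<noteq> 0" using volume_transform[OF assms(1-3)] by auto
  then obtain B where B: "B ** matrix (d\<phi> x) = mat 1"
    using invertible_det_nz[of "matrix (d\<phi> x)"] unfolding invertible_def by blast
  have in_image: "transition c d x \<in> chart_image d" if "x \<in> overlap c d" for x
    using that assms(1) by (auto simp: overlap_def transition_apply chart_image_def)
  show ?thesis
    using trace_spray_coeff_transform[OF x y
        smooth_on_differentiable[OF smooth_spray_coeff[OF assms(1)] U(1)]
        smooth_on_differentiable[OF smooth_spray_coeff[OF assms(2)] U(2)]
        spray_coeff_transform[OF assms(1-3)] B]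
      ln_volume_transform[OF x c.open_X c.smooth_\<sigma> c.\<sigma>_pos _ d.open_X d.smooth_\<sigma> d.\<sigma>_pos in_image
        volume_transform[OF assms(1,2)] B, of y]
      S_curvature_eq[OF smooth_spray_coeff[OF assms(1)] U(1) c.smooth_ln_\<sigma> c.U_X[OF U(1)]]
      S_curvature_eq[OF smooth_spray_coeff[OF assms(2)] U(2) d.smooth_ln_\<sigma> d.U_X[OF U(2)]]
      c.U_X[OF U(1)]
    by simp
qed

section \<open>The associated spray as a global field\<close>

definition global_S :: "('a, 'n) tangent \<Rightarrow> real" where
  "global_S v = (let c = SOME c. c \<in> A \<and> v \<in> chart_dom (sc c) in Scurv c (chart_map (sc c) v))"

text \<open>Invariance under coordinate changes makes the chart picked by \<open>SOME\<close>
  immaterial.\<close>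

lemma global_S_eq:
  assumes "c \<in> A" "v \<in> chart_dom (sc c)"
  shows "global_S v = Scurv c (chart_map (sc c) v)"
proof -
  define d where "d = (SOME d. d \<in> A \<and> v \<in> chart_dom (sc d))"
  have d: "d \<in> A" "v \<in> chart_dom (sc d)"
    using someI[of "\<lambda>d. d \<in> A \<and> v \<in> chart_dom (sc d)" c] assms unfolding d_def by auto
  obtain x y where xy: "chart_map (sc d) v = (x, y)" by fastforce
  note x = slit_chart_map_change[OF d(1) assms(1) d(2) assms(2) xy]
  show ?thesis
    using S_curvature_invariant[OF d(1) assms(1) x(1,2)]
    by (simp add: global_S_def d_def[symmetric] xy x(3))
qed

text \<open>Adds a multiple of the canonical vertical field, with components \<open>(0, y)\<close>.
  The vertical component of a spray is -2 times its coefficients, so subtracting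
  \<open>S y / (n + 1)\<close> from these means adding twice that amount here.\<close>

definition hat :: "('a, 'n) slit_field" where
  "hat v s = (if s \<in> sc ` A \<and> v \<in> chart_dom s
    then G v s + (2 * global_S v / (real CARD('n) + 1)) *\<^sub>R (0, snd (chart_map s v)) else 0)"

lemma component_hat:
  assumes c: "c \<in> A" and z: "z \<in> U c"
  shows "component hat (sc c) z
    = component G (sc c) z + (2 / (real CARD('n) + 1) * Scurv c z) *\<^sub>R (0, snd z)"
proof -
  obtain v where v: "v \<in> chart_dom (sc c)" "z = chart_map (sc c) v"
    using z by (auto simp: chart_image_def)
  then show ?thesis
    using c by (simp add: component_slit_chart hat_def global_S_eq)
qed

text \<open>The multiplier is a function on the bundle, and the canonical vertical field is
  preserved by transitions: the second-order term of their differential sees only horizontal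
  components, which are zero for it.\<close>

lemma hat_in_tangent_space:
  assumes v: "v \<in> (\<Union>s\<in>sc ` A. chart_dom s)"
  shows "hat v \<in> tangent_space (sc ` A) v"
proof -
  have "hat v (sc d) = d_transition (sc c) (sc d) v (hat v (sc c))"
    if cd: "c \<in> A" "d \<in> A" and vc: "v \<in> chart_dom (sc c)" "v \<in> chart_dom (sc d)" for c d
  proof -
    interpret coordinate_change "overlap c d" "transition c d"
      by (rule coordinate_change[OF cd])
    obtain x y where xy: "chart_map (sc c) v = (x, y)" by fastforce
    note x = slit_chart_map_change[OF cd vc xy]
    let ?T = "d_transition (sc c) (sc d) v" and ?k = "2 * global_S v / (real CARD('n) + 1)"
    note T = d_transition_slit_chart[OF cd vc xy]
    have "linear ?T"
      by (rule linearI)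
        (simp_all add: T linear_add[OF linear_d\<phi>[OF x(1)]] linear_add[OF linear_dd\<phi>(1)[OF x(1)]]
          linear_scale[OF linear_d\<phi>[OF x(1)]] linear_scale[OF linear_dd\<phi>(1)[OF x(1)]]
          scaleR_right_distrib)
    then have "?T (hat v (sc c)) = ?T (G v (sc c)) + ?k *\<^sub>R ?T (0, y)"
      using cd vc by (simp add: hat_def xy linear_add linear_scale del: scaleR_Pair)
    also have "?T (0, y) = (0, d\<phi> x y)"
      by (simp add: T linear_0[OF linear_d\<phi>[OF x(1)]] linear_0[OF linear_dd\<phi>(1)[OF x(1)]])
    also have "?T (G v (sc c)) = G v (sc d)"
    proof -
      have "G v \<in> tangent_space (sc ` A) v"
        using spray v unfolding spray_def vector_field_def by blast
      from tangent_space_transition[OF this imageI[OF cd(1)] imageI[OF cd(2)] vc]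
      show ?thesis by (rule sym)
    qed
    finally show ?thesis using cd vc by (simp add: hat_def x(3))
  qed
  moreover have "hat v s = 0" if "s \<notin> sc ` A \<or> v \<notin> chart_dom s" for s
    using that by (auto simp: hat_def)
  ultimately show ?thesis unfolding tangent_space_def by blast
qed

lemma smooth_component_hat:
  assumes c: "c \<in> A" shows "smooth_on (U c) (component hat (sc c))"
proof (rule smooth_on_cong[OF open_slit_chart_image[OF c] component_hat[OF c, symmetric]])
  interpret local_spray_volume "U c" "coeff c" "chart_image c" "\<sigma> c"
    by (rule local_spray_volume[OF c])
  have "smooth_on (U c) (\<lambda>z. (0::real^'n, snd z))"
    by (intro smooth_on_bounded_linear open_U bounded_linear_Pair bounded_linear_zero bounded_linear_snd)
  then show "smooth_on (U c)
      (\<lambda>z. component G (sc c) z + (2 / (real CARD('n) + 1) * Scurv c z) *\<^sub>R (0, snd z))"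
    using smooth_component[OF c] smooth_S
    by (intro smooth_on_add open_U smooth_on_scaleR smooth_on_mult smooth_on_const)
qed assumption

lemma spray_coeff_hat:
  assumes c: "c \<in> A" and z: "z \<in> U c"
  shows "spray_coeff A hat c z = coeff c z - (Scurv c z / (real CARD('n) + 1)) *\<^sub>R snd z"
  unfolding spray_coeff_def component_hat[OF assms]
  by (simp add: scaleR_right_distrib scaleR_right_diff_distrib)

lemma associated_spray_hat: "associated_spray A G dV hat"
proof -
  have "fst (component hat (sc c) (x, y)) = y \<and>
      (\<forall>l>0. spray_coeff A hat c (x, l *\<^sub>R y) = l\<^sup>2 *\<^sub>R spray_coeff A hat c (x, y))"
    if c: "c \<in> A" and z: "(x, y) \<in> U c" for c x y
  proof -
    interpret local_spray_volume "U c" "coeff c" "chart_image c" "\<sigma> c"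
      by (rule local_spray_volume[OF c])
    interpret hat: local_spray "U c" "spray_coeff A hat c"
      by (rule associated_local_spray[OF spray_coeff_hat[OF c]])
    have "spray_coeff A hat c (x, l *\<^sub>R y) = l\<^sup>2 *\<^sub>R spray_coeff A hat c (x, y)" if "l > 0" for l
      using hat.homogeneous_G z that by (fastforce simp: homogeneous_def vec_eq_iff)
    then show ?thesis by (simp add: component_hat[OF c z] component_G[OF c z])
  qed
  then have "spray A hat"
    unfolding spray_def vector_field_def
    using hat_in_tangent_space smooth_component_hat by blast
  then show ?thesis
    unfolding associated_spray_def using spray_coeff_hat by blast
qed

text \<open>Over \<open>U c\<close> the coefficients of \<open>H\<close> are given by the formula in
  \<open>associated_spray\<close>, and the chart computation asks for nothing else about
  \<open>H\<close>.\<close>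

lemma associated_spray_chi_curvature_eq_0:
  assumes H: "associated_spray A G dV H" and c: "c \<in> A" and z: "z \<in> U c"
  shows "chi_curvature (spray_coeff A H c) k z = 0"
proof -
  interpret local_spray_volume "U c" "coeff c" "chart_image c" "\<sigma> c"
    by (rule local_spray_volume[OF c])
  show ?thesis
    by (rule associated_chi_curvature_eq_0[OF _ z])
      (use H c in \<open>auto simp: associated_spray_def\<close>)
qed

end

text \<open>As a total function, \<open>Ghat\<close> is free outside the slit tangent bundle and so
  not literally unique; hence existence is paired with vanishing for every associated spray.\<close>

theorem theorem1p1:
  fixes M :: "'a topology"
    and A :: "('a, real^'n) chart set"
    and G :: "('a, 'n) slit_field"
    and dV :: "'a \<Rightarrow> ('a, real^'n) chart \<Rightarrow> real"
  assumes "smooth_manifold M A"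
    and "spray A G"
    and "volume_form A dV"
  shows "(\<exists>Ghat. associated_spray A G dV Ghat) \<and>
    (\<forall>Ghat. associated_spray A G dV Ghat \<longrightarrow>
      (\<forall>c\<in>A. \<forall>z \<in> chart_image (slit_chart A c). \<forall>k.
         chi_curvature (spray_coeff A Ghat c) k z = 0))"
proof -
  interpret spray_volume M A G dV
    by unfold_locales (fact assms)+
  show ?thesis
    using associated_spray_hat associated_spray_chi_curvature_eq_0 by blast
qed

end
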